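(* Let $d\ge1$ be an integer. The class $\mathcal D$ of $d$-parameter sequences strictly contains the class $B(1)\cap\mathfrak M_\infty$ of $d$-parameter bounded Besicovitch sequences.
   Context: Multi-indices: $\mathbb N$ contains $0$. For $\mathbf k\in\mathbb Z^d$, $\mathbf z\in\mathbb C^d$: $\mathbf z^{\mathbf k}=z_1^{k_1}\cdots z_d^{k_d}$; $|\mathbf{n+1}|=(n_1+1)\cdots(n_d+1)$. Sums $\sum_{\mathbf k=\mathbf a}^{\mathbf b}$ run over all $\mathbf k$ with $a_j\le k_j\le b_j$ for all $j$. $\lim_{\mathbf n}$ and $\limsup_{\mathbf n}$ are taken as all coordinates $n_j\to\infty$ jointly: for every $\varepsilon>0$ there is $\mathbf N\in\mathbb N^d$ such that the condition holds whenever $n_j>N_j$ for all $j$. $\mathbb T^d=\{\mathbf z\in\mathbb C^d:|z_j|=1\ \forall j\}$. Bounded Besicovitch sequences: a trigonometric polynomial is a sequence $P(\mathbf k)=\sum_\alpha c_\alpha\mathbf z_\alpha^{\mathbf k}$ (finite sum, $c_\alpha\in\mathbb C$, $\mathbf z_\alpha\in\mathbb T^d$), $\mathbf k\in\mathbb N^d$. $\mathbf a=\{a(\mathbf k)\}_{\mathbf k\in\mathbb N^d}\subset\mathbb C$ belongs to $B(1)$ if for every $\varepsilon>0$ there is a trigonometric polynomial $P_\varepsilon$ with $\limsup_{\mathbf n}\frac1{|\mathbf{n+1}|}\sum_{\mathbf k=\mathbf 0}^{\mathbf n}|a(\mathbf k)-P_\varepsilon(\mathbf k)|<\varepsilon$.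 $\mathfrak M_\infty$ is the set of bounded sequences. $\mathbf a$ is bounded Besicovitch if $\mathbf a\in B(1)\cap\mathfrak M_\infty$. Class $S$: extend $\mathbf a=\{a(\mathbf k)\}_{\mathbf k\in\mathbb N^d}$ to $\mathbb Z^d$ by $a(\mathbf k)=0$ for $\mathbf k\in\mathbb Z^d\setminus\mathbb N^d$. $\mathbf a\in S$ if $\gamma_{\mathbf a}(\mathbf m)=\lim_{\mathbf n}\frac1{|\mathbf{n+1}|}\sum_{\mathbf k=-\mathbf n}^{\mathbf n}\overline{a(\mathbf k)}\,a(\mathbf k+\mathbf m)$ exists for all $\mathbf m\in\mathbb Z^d$. Then $\gamma_{\mathbf a}$ is positive definite on $\mathbb Z^d$, and the spectral measure $\sigma_{\mathbf a}$ is the unique positive Borel measure on $\mathbb T^d$ with $\gamma_{\mathbf a}(\mathbf m)=\int_{\mathbb T^d}\mathbf z^{\mathbf m}\,d\sigma_{\mathbf a}(\mathbf z)$ for all $\mathbf m$. Class $\mathcal D$: the set of all $\mathbf a\in S\cap\ell_\infty(\mathbb N^d)$ such that (1) $\sigma_{\mathbf a}$ is discrete (purely atomic), and (2) $\lim_{\mathbf n}\frac1{|\mathbf{n+1}|}\sum_{\mathbf k=\mathbf 0}^{\mathbf n}a(\mathbf k)\mathbf z^{\mathbf k}$ exists for all $\mathbf z\in\mathbb T^d$. *)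

theory Defs
  imports "HOL-Analysis.Analysis"
begin

text \<open>
  The parameter \<open>d \<ge> 1\<close> is the cardinality of a finite index type \<open>'d\<close>; multi-indices are
  vectors in \<open>nat ^ 'd\<close> or \<open>int ^ 'd\<close>, ordered componentwise. Hence \<open>{a..b}\<close> is the box of
  all \<open>k\<close> with \<open>a $ j \<le> k $ j \<le> b $ j\<close> for all \<open>j\<close>, and \<open>at_top\<close> on \<open>nat ^ 'd\<close> is the
  filter of all coordinates tending to infinity jointly. The following two lemmas confirm this reading.
\<close>

lemma eventually_at_top_multi_index:
  fixes P :: "nat ^ 'd \<Rightarrow> bool"
  shows "eventually P at_top \<longleftrightarrow> (\<exists>N. \<forall>n. (\<forall>j. n $ j > N $ j) \<longrightarrow> P n)"
proof -
  have dir: "\<exists>c\<in>UNIV. principal {c..} \<le> inf (principal {a..}) (principal {b..})"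
    for a b :: "nat ^ 'd"
    by (rule bexI[of _ "\<chi> j. max (a $ j) (b $ j)"]) (auto simp: less_eq_vec_def)
  have "eventually P at_top \<longleftrightarrow> (\<exists>N. \<forall>n\<ge>N. P n)"
    unfolding at_top_def
    by (subst eventually_INF_base) (use dir in \<open>auto simp: eventually_principal\<close>)
  also have "\<dots> \<longleftrightarrow> (\<exists>N. \<forall>n. (\<forall>j. n $ j > N $ j) \<longrightarrow> P n)"
  proof
    assume "\<exists>N. \<forall>n\<ge>N. P n"
    then show "\<exists>N. \<forall>n. (\<forall>j. n $ j > N $ j) \<longrightarrow> P n"
      unfolding less_eq_vec_def by (meson less_imp_le)
  next
    assume "\<exists>N. \<forall>n. (\<forall>j. n $ j > N $ j) \<longrightarrow> P n"
    then obtain N where N: "\<And>n. (\<forall>j. n $ j > N $ j) \<Longrightarrow> P n" by blast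
    show "\<exists>N. \<forall>n\<ge>N. P n"
      by (rule exI[of _ "\<chi> j. Suc (N $ j)"]) (auto simp: less_eq_vec_def Suc_le_eq intro!: N)
  qed
  finally show ?thesis .
qed

lemma finite_box:
  fixes a b :: "'a::{order} ^ 'd"
  assumes "\<And>j. finite {a $ j..b $ j}"
  shows "finite {a..b}"
proof (rule finite_subset)
  show "{a..b} \<subseteq> vec_lambda ` (Pi\<^sub>E UNIV (\<lambda>j. {a $ j..b $ j}))"
  proof
    fix x assume "x \<in> {a..b}"
    then have "vec_nth x \<in> Pi\<^sub>E UNIV (\<lambda>j. {a $ j..b $ j})"
      by (auto simp: less_eq_vec_def)
    then show "x \<in> vec_lambda ` (Pi\<^sub>E UNIV (\<lambda>j. {a $ j..b $ j}))"
      by (metis image_eqI vec_nth_inverse)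
  qed
  show "finite (vec_lambda ` (Pi\<^sub>E UNIV (\<lambda>j. {a $ j..b $ j})))"
    using assms by (intro finite_imageI finite_PiE) auto
qed

definition mpow :: "complex ^ 'd \<Rightarrow> int ^ 'd \<Rightarrow> complex" where
  "mpow z k = (\<Prod>j\<in>UNIV. (z $ j) powi (k $ j))"

definition int_vec :: "nat ^ 'd \<Rightarrow> int ^ 'd" where
  "int_vec n = (\<chi> j. int (n $ j))"

definition torus :: "(complex ^ 'd) set" where
  "torus = {z. \<forall>j. norm (z $ j) = 1}"

text \<open>The normalising factor \<open>|n + 1|\<close>.\<close>

definition box_size :: "nat ^ 'd \<Rightarrow> nat" where
  "box_size n = (\<Prod>j\<in>UNIV. n $ j + 1)"


subsection \<open>Bounded Besicovitch sequences\<close>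

definition trig_poly :: "(nat ^ 'd \<Rightarrow> complex) \<Rightarrow> bool" where
  "trig_poly P \<longleftrightarrow>
     (\<exists>(r::nat) c w. (\<forall>i<r. w i \<in> torus) \<and> P = (\<lambda>k. \<Sum>i<r. c i * mpow (w i) (int_vec k)))"

definition besicovitch_1 :: "(nat ^ 'd \<Rightarrow> complex) set" where
  "besicovitch_1 = {a. \<forall>\<epsilon>>0. \<exists>P. trig_poly P \<and>
     Limsup at_top (\<lambda>n. ereal ((\<Sum>k\<in>{0..n}. norm (a k - P k)) / real (box_size n))) < ereal \<epsilon>}"

definition bounded_seqs :: "(nat ^ 'd \<Rightarrow> complex) set" where
  "bounded_seqs = {a. bounded (range a)}"


subsection \<open>The class S and spectral measures\<close>

definition zero_ext :: "(nat ^ 'd \<Rightarrow> complex) \<Rightarrow> int ^ 'd \<Rightarrow> complex" where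
  "zero_ext a k = (if \<forall>j. 0 \<le> k $ j then a (\<chi> j. nat (k $ j)) else 0)"

definition correlation_avg :: "(nat ^ 'd \<Rightarrow> complex) \<Rightarrow> int ^ 'd \<Rightarrow> nat ^ 'd \<Rightarrow> complex" where
  "correlation_avg a m n =
     (\<Sum>k\<in>{- int_vec n..int_vec n}. cnj (zero_ext a k) * zero_ext a (k + m)) / of_nat (box_size n)"

definition class_S :: "(nat ^ 'd \<Rightarrow> complex) set" where
  "class_S = {a. \<forall>m. \<exists>l. (correlation_avg a m \<longlongrightarrow> l) at_top}"

definition correlation :: "(nat ^ 'd \<Rightarrow> complex) \<Rightarrow> int ^ 'd \<Rightarrow> complex" where
  "correlation a m = Lim at_top (correlation_avg a m)"

text \<open>
  Finiteness is forced by integrability of the constant function 1, but has to be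
  stated because the Bochner integral of a non-integrable function is 0.
\<close>

definition is_spectral_measure :: "(nat ^ 'd \<Rightarrow> complex) \<Rightarrow> (complex ^ 'd) measure \<Rightarrow> bool" where
  "is_spectral_measure a \<sigma> \<longleftrightarrow>
     finite_measure \<sigma> \<and> sets \<sigma> = sets (restrict_space borel torus) \<and>
     (\<forall>m. correlation a m = (\<integral>z. mpow z m \<partial>\<sigma>))"

definition discrete_measure :: "'a measure \<Rightarrow> bool" where
  "discrete_measure M \<longleftrightarrow> (\<exists>A\<in>sets M. countable A \<and> emeasure M (space M - A) = 0)"


subsection \<open>The class D\<close>

text \<open>
  By Herglotz--Bochner, every bounded sequence in \<open>class_S\<close> has exactly one spectral measure,
  so the existential quantifier below speaks about that measure.
\<close>

definition class_D :: "(nat ^ 'd \<Rightarrow> complex) set" where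
  "class_D = {a \<in> class_S \<inter> bounded_seqs.
     (\<exists>\<sigma>. is_spectral_measure a \<sigma> \<and> discrete_measure \<sigma>) \<and>
     (\<forall>z\<in>torus. \<exists>l. ((\<lambda>n. (\<Sum>k\<in>{0..n}. a k * mpow z (int_vec k)) / of_nat (box_size n))
        \<longlongrightarrow> l) at_top)}"

end

theory Submission
  imports Defs "HOL-Real_Asymp.Real_Asymp"
begin

text \<open>
  For the inclusion, let \<open>A w\<close> be the mean of \<open>a k * cnj (w\<^sup>k)\<close>, which exists because it does for
  trigonometric polynomials. Since \<open>a\<close> is bounded, approximation in mean improves to
  approximation in quadratic mean, and least squares show that the partial sums of the Fourier
  series \<open>\<Sum>w. A w * w\<^sup>k\<close> already approximate \<open>a\<close>. Hence the correlation at \<open>m\<close> is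
  \<open>\<Sum>w. |A w|\<^sup>2 * w\<^sup>m\<close>, and the spectral measure is the sum of the point masses \<open>|A w|\<^sup>2\<close>.

  The inclusion is strict because of \<open>exp (i \<surd>(k $ j))\<close>: it varies so slowly that its spectral
  measure is the unit mass at \<open>1\<close>, yet all its Fourier coefficients vanish, which contradicts the
  formula above for the correlation.
\<close>

subsection \<open>Averages over boxes\<close>

definition box_avg :: "(nat ^ 'd \<Rightarrow> 'b::real_normed_field) \<Rightarrow> nat ^ 'd \<Rightarrow> 'b" where
  "box_avg f n = (\<Sum>k\<in>{0..n}. f k) / of_nat (box_size n)"

lemma box_size_pos [simp]: "box_size n > 0"
  by (simp add: box_size_def prod_pos)

lemma finite_nat_box [simp]: "finite {a..b :: nat ^ 'd}"
  by (rule finite_box) simp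

lemma at_top_multi_index_neq_bot [simp]: "(at_top :: (nat ^ 'd) filter) \<noteq> bot"
proof -
  have "\<not> eventually (\<lambda>_. False) (at_top :: (nat ^ 'd) filter)"
    unfolding eventually_at_top_multi_index
    by (auto intro!: exI[of _ "\<chi> j. Suc (N $ j)" for N])
  then show ?thesis by (simp add: trivial_limit_def)
qed

lemma filterlim_vec_nth_at_top:
  "filterlim (\<lambda>n :: nat ^ 'd. n $ j) at_top at_top"
  unfolding filterlim_at_top eventually_at_top_multi_index
  by (intro allI, rule_tac x="\<chi> j. Z" in exI) (auto intro: less_imp_le)

lemma bij_betw_vec_nth_box:
  fixes n :: "nat ^ 'd"
  shows "bij_betw vec_nth {0..n} (Pi\<^sub>E UNIV (\<lambda>j. {..n $ j}))"
proof (rule bij_betwI[where g = vec_lambda])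
qed (auto simp: less_eq_vec_def PiE_def Pi_def)

text \<open>A box is a product of intervals, so distributivity factors the sum. This reduces
  explicit averages in several variables to Cesaro means in one variable.\<close>

lemma box_avg_prod:
  fixes f :: "'d::finite \<Rightarrow> nat \<Rightarrow> 'b::real_normed_field"
  shows "box_avg (\<lambda>k. \<Prod>j\<in>UNIV. f j (k $ j)) n =
    (\<Prod>j\<in>UNIV. (\<Sum>t\<le>n $ j. f j t) / of_nat (Suc (n $ j)))"
proof -
  have "(\<Sum>k\<in>{0..n}. \<Prod>j\<in>UNIV. f j (k $ j)) = (\<Sum>g\<in>Pi\<^sub>E UNIV (\<lambda>j. {..n $ j}). \<Prod>j\<in>UNIV. f j (g j))"
    by (rule sum.reindex_bij_betw[OF bij_betw_vec_nth_box])
  also have "\<dots> = (\<Prod>j\<in>UNIV. \<Sum>t\<le>n $ j. f j t)"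
    by (rule prod_sum_PiE[symmetric]) auto
  finally show ?thesis
    by (simp add: box_avg_def box_size_def prod_dividef)
qed

lemma card_box: "card {0..n :: nat ^ 'd} = box_size n"
proof -
  \<comment> \<open>With all factors equal to 1, the product formula counts the points of the
    box.\<close>
  have "box_avg (\<lambda>k. \<Prod>j\<in>(UNIV::'d set). 1) n = (1 :: real)"
    by (subst box_avg_prod) simp
  then have "real (card {0..n}) = real (box_size n)"
    using box_size_pos[of n] by (simp add: box_avg_def field_simps)
  then show ?thesis by linarith
qed

lemma box_avg_const [simp]: "box_avg (\<lambda>_. c) n = c"
  using box_size_pos[of n] by (simp add: box_avg_def card_box del: box_size_pos)

lemma box_avg_add: "box_avg (\<lambda>k. f k + g k) n = box_avg f n + box_avg g n"
  by (simp add: box_avg_def sum.distrib add_divide_distrib)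

lemma box_avg_diff: "box_avg (\<lambda>k. f k - g k) n = box_avg f n - box_avg g n"
  by (simp add: box_avg_def sum_subtractf diff_divide_distrib)

lemma box_avg_cmult: "box_avg (\<lambda>k. c * f k) n = c * box_avg f n"
  by (simp add: box_avg_def sum_distrib_left)

lemma box_avg_sum: "box_avg (\<lambda>k. \<Sum>i\<in>I. f i k) n = (\<Sum>i\<in>I. box_avg (f i) n)"
  unfolding box_avg_def by (subst sum.swap) (simp add: sum_divide_distrib)

lemma box_avg_cnj: "box_avg (\<lambda>k. cnj (f k)) n = cnj (box_avg f n)"
  by (simp add: box_avg_def)

lemma box_avg_mono:
  fixes f :: "nat ^ 'd \<Rightarrow> real"
  assumes "\<And>k. f k \<le> g k"
  shows "box_avg f n \<le> box_avg g n"
  unfolding box_avg_def by (intro divide_right_mono sum_mono assms) simp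

lemma norm_box_avg_le: "norm (box_avg f n) \<le> box_avg (\<lambda>k. norm (f k)) n"
  by (simp add: box_avg_def norm_divide divide_right_mono norm_sum)

lemma tendsto_box_avg_prod:
  fixes f :: "'d::finite \<Rightarrow> nat \<Rightarrow> 'b::real_normed_field"
  assumes "\<And>j. (\<lambda>N. (\<Sum>t\<le>N. f j t) / of_nat (Suc N)) \<longlonglongrightarrow> l j"
  shows "(box_avg (\<lambda>k. \<Prod>j\<in>UNIV. f j (k $ j)) \<longlongrightarrow> (\<Prod>j\<in>UNIV. l j)) at_top"
  unfolding box_avg_prod[abs_def]
  by (intro tendsto_prod filterlim_compose[OF assms filterlim_vec_nth_at_top])

section \<open>Cesaro means of sequences in one variable\<close>

lemma cesaro_null:
  fixes f :: "nat \<Rightarrow> 'b::real_normed_field"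
  assumes "f \<longlonglongrightarrow> 0"
  shows "(\<lambda>N. (\<Sum>t\<le>N. f t) / of_nat (Suc N)) \<longlonglongrightarrow> 0"
proof (rule LIMSEQ_I)
  fix e :: real assume e: "e > 0"
  then obtain M where M: "\<And>t. t \<ge> M \<Longrightarrow> norm (f t) < e / 2"
    using LIMSEQ_D[OF assms, of "e/2"] by auto
  define B where "B = (\<Sum>t<M. norm (f t))"
  have "(\<lambda>N. B / real (Suc N)) \<longlonglongrightarrow> 0"
    by (intro real_tendsto_divide_at_top[OF tendsto_const] filterlim_compose[OF filterlim_real_sequentially filterlim_Suc])
  then obtain K where K: "\<And>N. N \<ge> K \<Longrightarrow> norm (B / real (Suc N)) < e / 2"
    using e LIMSEQ_D[of "\<lambda>N. B / real (Suc N)" 0 "e/2"] by auto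
  show "\<exists>no. \<forall>N\<ge>no. norm ((\<Sum>t\<le>N. f t) / of_nat (Suc N) - 0) < e"
  proof (intro exI allI impI)
    fix N assume N: "N \<ge> K"
    have "norm (\<Sum>t\<le>N. f t) \<le> (\<Sum>t\<le>N. norm (f t))" by (rule norm_sum)
    \<comment> \<open>Terms from \<open>M\<close> on are covered by \<open>e / 2\<close>; the
      finitely many earlier ones add at most \<open>B\<close>, which is negligible once
      \<open>N \<ge> K\<close>.\<close>
    also have "\<dots> \<le> (\<Sum>t\<le>N. (if t < M then norm (f t) else 0) + e / 2)"
      using e by (intro sum_mono) (auto dest!: M leI intro: less_imp_le)
    also have "\<dots> = (\<Sum>t\<in>{..N} \<inter> {..<M}. norm (f t)) + Suc N * (e / 2)"
      by (subst sum.distrib, subst sum.inter_restrict) (auto intro!: sum.cong)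
    also have "\<dots> \<le> B + Suc N * (e / 2)"
      unfolding B_def by (intro add_right_mono sum_mono2) auto
    finally have "norm (\<Sum>t\<le>N. f t) / Suc N \<le> (B + Suc N * (e / 2)) / Suc N"
      by (rule divide_right_mono) simp
    also have "\<dots> = B / Suc N + e / 2" by (simp add: add_divide_distrib del: of_nat_Suc)
    also have "\<dots> < e" using K[OF N] abs_ge_self[of "B / Suc N"] unfolding real_norm_def by linarith
    finally show "norm ((\<Sum>t\<le>N. f t) / of_nat (Suc N) - 0) < e"
      by (simp add: norm_divide del: of_nat_Suc)
  qed
qed

lemma cesaro:
  fixes f :: "nat \<Rightarrow> 'b::real_normed_field"
  assumes "f \<longlonglongrightarrow> l"
  shows "(\<lambda>N. (\<Sum>t\<le>N. f t) / of_nat (Suc N)) \<longlonglongrightarrow> l"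
proof -
  have "(\<lambda>N. (\<Sum>t\<le>N. f t - l) / of_nat (Suc N)) \<longlonglongrightarrow> 0"
    using assms by (intro cesaro_null) (simp add: LIM_zero)
  moreover have "(\<Sum>t\<le>N. f t - l) / of_nat (Suc N) = (\<Sum>t\<le>N. f t) / of_nat (Suc N) - l" for N
    by (simp add: sum_subtractf diff_divide_distrib del: of_nat_Suc)
  ultimately show ?thesis by (simp add: LIM_zero_cancel)
qed

text \<open>Summation by parts: \<open>z - 1\<close> times the sum is a bounded boundary term minus
  the sum of \<open>(f (Suc t) - f t) * z ^ Suc t\<close>, whose Cesaro mean vanishes with the
  increments.\<close>

lemma cesaro_powers_null:
  fixes f :: "nat \<Rightarrow> complex"
  assumes "norm z = 1" "z \<noteq> 1" "bounded (range f)" "(\<lambda>t. f (Suc t) - f t) \<longlonglongrightarrow> 0"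
  shows "(\<lambda>N. (\<Sum>t\<le>N. f t * z ^ t) / of_nat (Suc N)) \<longlonglongrightarrow> 0"
proof -
  obtain B where B: "\<And>t. norm (f t) \<le> B"
    using assms(3) by (auto simp: bounded_iff)
  have 1: "(\<lambda>N. (\<Sum>t\<le>N. (f (Suc t) - f t) * z ^ Suc t) / of_nat (Suc N)) \<longlonglongrightarrow> 0"
  proof (rule cesaro_null, rule Lim_null_comparison)
    show "\<forall>\<^sub>F t in sequentially. norm ((f (Suc t) - f t) * z ^ Suc t) \<le> norm (f (Suc t) - f t)"
      using assms(1) by (simp add: norm_mult norm_power)
    show "(\<lambda>t. norm (f (Suc t) - f t)) \<longlonglongrightarrow> 0"
      using assms(4) by (rule tendsto_norm_zero)
  qed
  have 2: "(\<lambda>N. (f (Suc N) * z ^ Suc N - f 0) / of_nat (Suc N)) \<longlonglongrightarrow> 0"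
  proof (rule Lim_null_comparison)
    show "\<forall>\<^sub>F N in sequentially. norm ((f (Suc N) * z ^ Suc N - f 0) / of_nat (Suc N)) \<le> 2 * B / real (Suc N)"
    proof (intro always_eventually allI)
      fix N
      have "norm (f (Suc N) * z ^ Suc N - f 0) \<le> norm (f (Suc N) * z ^ Suc N) + norm (f 0)"
        by (rule norm_triangle_ineq4)
      also have "\<dots> \<le> 2 * B"
        using B[of 0] B[of "Suc N"] assms(1) by (simp add: norm_mult norm_power)
      finally show "norm ((f (Suc N) * z ^ Suc N - f 0) / of_nat (Suc N)) \<le> 2 * B / real (Suc N)"
        unfolding norm_divide norm_of_nat by (rule divide_right_mono) simp
    qed
    show "(\<lambda>N. 2 * B / real (Suc N)) \<longlonglongrightarrow> 0"
      by (intro real_tendsto_divide_at_top[OF tendsto_const] filterlim_compose[OF filterlim_real_sequentially filterlim_Suc])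
  qed
  have tel: "(\<Sum>t\<le>N. f (Suc t) * z ^ Suc t - f t * z ^ t) = f (Suc N) * z ^ Suc N - f 0" for N
    by (induction N) auto
  have eq: "(\<Sum>t\<le>N. f t * z ^ t) / of_nat (Suc N) =
      ((f (Suc N) * z ^ Suc N - f 0) / of_nat (Suc N) - (\<Sum>t\<le>N. (f (Suc t) - f t) * z ^ Suc t) / of_nat (Suc N)) / (z - 1)" for N
  proof -
    have "f (Suc N) * z ^ Suc N - f 0 - (\<Sum>t\<le>N. (f (Suc t) - f t) * z ^ Suc t) = (z - 1) * (\<Sum>t\<le>N. f t * z ^ t)"
      unfolding tel[symmetric] sum_subtractf[symmetric] sum_distrib_left
      by (intro sum.cong) (auto simp: algebra_simps)
    then show ?thesis using assms(2) by (simp add: diff_divide_distrib[symmetric] del: of_nat_Suc)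
  qed
  show ?thesis unfolding eq using tendsto_divide[OF tendsto_diff[OF 2 1] tendsto_const, of "z-1"] assms(2) by simp
qed

lemma cesaro_powers:
  fixes z :: complex
  assumes "norm z = 1"
  shows "(\<lambda>N. (\<Sum>t\<le>N. z ^ t) / of_nat (Suc N)) \<longlonglongrightarrow> (if z = 1 then 1 else 0)"
proof (cases "z = 1")
  case True then show ?thesis using cesaro[OF tendsto_const[of "1::complex"]] by (simp del: sum_constant of_nat_Suc)
next
  case False
  then show ?thesis using cesaro_powers_null[of z "\<lambda>_. 1"] assms by auto
qed

subsection \<open>Trigonometric sums\<close>

text \<open>Indexing by a set makes the frequencies distinct, so that \<open>c\<close> gives the
  Fourier coefficients. Exponents are integers because the sum is also evaluated at shifted indices
  outside the orthant.\<close>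

definition trig_sum :: "(complex ^ 'd) set \<Rightarrow> (complex ^ 'd \<Rightarrow> complex) \<Rightarrow> int ^ 'd \<Rightarrow> complex" where
  "trig_sum F c k = (\<Sum>w\<in>F. c w * mpow w k)"

lemma norm_mpow: "w \<in> torus \<Longrightarrow> norm (mpow w k) = 1"
  by (simp add: mpow_def torus_def norm_power_int flip: prod_norm)

lemma mpow_int_vec: "mpow w (int_vec k) = (\<Prod>j\<in>UNIV. (w $ j) ^ (k $ j))"
  by (simp add: mpow_def int_vec_def)

lemma mpow_add:
  assumes "w \<in> torus"
  shows "mpow w (k + m) = mpow w k * mpow w m"
proof -
  have "w $ j \<noteq> 0" for j using assms by (metis (mono_tags) torus_def mem_Collect_eq norm_zero zero_neq_one)
  then show ?thesis by (simp add: mpow_def power_int_add prod.distrib)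
qed

lemma mpow_0 [simp]: "mpow w 0 = 1"
  by (simp add: mpow_def)

lemma box_avg_mpow:
  assumes "w \<in> torus"
  shows "(box_avg (\<lambda>k. mpow w (int_vec k)) \<longlongrightarrow> (if w = 1 then 1 else 0)) at_top"
proof -
  have "(box_avg (\<lambda>k. \<Prod>j\<in>UNIV. (w $ j) ^ (k $ j)) \<longlongrightarrow> (\<Prod>j\<in>UNIV. if w $ j = 1 then 1 else 0)) at_top"
    using assms by (intro tendsto_box_avg_prod cesaro_powers) (simp add: torus_def)
  moreover have "(\<Prod>j\<in>UNIV. if w $ j = 1 then 1 else 0) = (if w = 1 then 1 else (0::complex))"
    by (auto simp: vec_eq_iff)
  ultimately show ?thesis by (simp add: mpow_int_vec)
qed

text \<open>Orthogonality of characters: the product is again a character, whose frequency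
  \<open>u\<close> is 1 exactly if \<open>w = v\<close>.\<close>

lemma box_avg_mpow_cnj:
  assumes "w \<in> torus" "v \<in> torus"
  shows "(box_avg (\<lambda>k. mpow w (int_vec k) * cnj (mpow v (int_vec k))) \<longlongrightarrow> (if w = v then 1 else 0)) at_top"
proof -
  define u where "u = (\<chi> j. w $ j * cnj (v $ j))"
  have *: "z * cnj y = 1 \<longleftrightarrow> z = y" if "norm y = 1" for z y :: complex
  proof -
    have "y * cnj y = 1" using that by (simp add: complex_norm_square[symmetric] del: of_real_power)
    then show ?thesis by (metis mult.assoc mult.commute mult_1)
  qed
  have u: "u \<in> torus" "u = 1 \<longleftrightarrow> w = v"
    using assms by (auto simp: u_def torus_def norm_mult vec_eq_iff *)
  have "mpow u (int_vec k) = mpow w (int_vec k) * cnj (mpow v (int_vec k))" for k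
    by (simp add: mpow_int_vec u_def power_mult_distrib prod.distrib)
  then show ?thesis using box_avg_mpow[OF u(1)] u(2) by simp
qed

subsection \<open>Correlations and shifts\<close>

text \<open>Completeness: being near a convergent function at every accuracy makes \<open>u\<close>
  Cauchy. The limits \<open>l\<close> may change with \<open>e\<close>, so no candidate limit has to
  be known.\<close>

lemma tendsto_if_approximable:
  fixes u :: "'a \<Rightarrow> complex"
  assumes "\<And>e. e > 0 \<Longrightarrow> \<exists>v l. (v \<longlongrightarrow> l) F \<and> (\<forall>\<^sub>F x in F. dist (u x) (v x) < e)"
  shows "\<exists>l. (u \<longlongrightarrow> l) F"
proof -
  have "cauchy_filter (filtermap u F)"
    unfolding cauchy_filter_metric_filtermap
  proof (intro allI impI)
    fix e :: real assume "e > 0"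
    then obtain v l where v: "(v \<longlongrightarrow> l) F" "\<forall>\<^sub>F x in F. dist (u x) (v x) < e / 4"
      using assms[of "e/4"] by auto
    have "\<forall>\<^sub>F x in F. dist (v x) l < e / 4"
      using v(1) \<open>e > 0\<close> by (intro tendstoD) auto
    with v(2) have "\<forall>\<^sub>F x in F. dist (u x) l < e / 2"
    proof eventually_elim
      case (elim x)
      then show ?case using dist_triangle[of "u x" l "v x"] by simp
    qed
    then show "\<exists>P. eventually P F \<and> (\<forall>x y. P x \<and> P y \<longrightarrow> dist (u x) (u y) < e)"
      by (intro exI[of _ "\<lambda>x. dist (u x) l < e / 2"]) (auto intro: dist_triangle_half_l)
  qed
  then have "convergent_filter (filtermap u F)"
    by (rule cauchy_filter_convergent)
  then show ?thesis
    by (auto simp: convergent_filter_iff filterlim_def)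
qed

text \<open>The factor \<open>cnj (zero_ext a k)\<close> vanishes outside the orthant, which cuts
  the symmetric box down to \<open>{0..n}\<close>. The shifted factor may still leave the orthant
  and keeps its extension.\<close>

lemma correlation_avg_eq_box_avg:
  fixes a :: "nat ^ 'd \<Rightarrow> complex"
  shows "correlation_avg a m = box_avg (\<lambda>k. cnj (a k) * zero_ext a (int_vec k + m))"
proof
  fix n :: "nat ^ 'd"
  have inj: "inj_on int_vec {0..n}"
    by (auto simp: inj_on_def int_vec_def vec_eq_iff)
  have sub: "int_vec ` {0..n} \<subseteq> {- int_vec n..int_vec n}"
    by (auto simp: int_vec_def less_eq_vec_def)
  have out: "zero_ext a k = 0" if "k \<in> {- int_vec n..int_vec n} - int_vec ` {0..n}" for k
  proof (rule ccontr)
    assume "zero_ext a k \<noteq> 0"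
    then have "\<forall>j. 0 \<le> k $ j" by (auto simp: zero_ext_def split: if_splits)
    then have "k = int_vec (\<chi> j. nat (k $ j))" "(\<chi> j. nat (k $ j)) \<in> {0..n}"
      using that by (auto simp: int_vec_def less_eq_vec_def vec_eq_iff nat_le_iff)
    then show False using that by blast
  qed
  have ext: "zero_ext a (int_vec k) = a k" for k
    by (simp add: zero_ext_def int_vec_def)
  have "(\<Sum>k\<in>{- int_vec n..int_vec n}. cnj (zero_ext a k) * zero_ext a (k + m)) =
      (\<Sum>k\<in>int_vec ` {0..n}. cnj (zero_ext a k) * zero_ext a (k + m))"
    by (rule sum.mono_neutral_right) (use out sub in \<open>auto intro: finite_box\<close>)
  also have "\<dots> = (\<Sum>k\<in>{0..n}. cnj (a k) * zero_ext a (int_vec k + m))"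
    by (simp add: sum.reindex[OF inj] ext)
  finally show "correlation_avg a m n = box_avg (\<lambda>k. cnj (a k) * zero_ext a (int_vec k + m)) n"
    by (simp add: correlation_avg_def box_avg_def)
qed

text \<open>The complementary indicator is a product of one-variable indicators that are eventually
  1, so it has mean 1.\<close>

lemma density_shifted_out_of_orthant:
  fixes m :: "int ^ 'd"
  shows "(box_avg (\<lambda>k. if \<forall>j. 0 \<le> int_vec k $ j + m $ j then 0 else 1 :: real) \<longlongrightarrow> 0) at_top"
proof -
  have "(box_avg (\<lambda>k. \<Prod>j\<in>(UNIV::'d set). if 0 \<le> int (k $ j) + m $ j then 1 else 0 :: real) \<longlongrightarrow> (\<Prod>j\<in>(UNIV::'d set). 1)) at_top"
  proof (rule tendsto_box_avg_prod, rule cesaro)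
    fix j
    have "\<forall>\<^sub>F t in sequentially. (if 0 \<le> int t + m $ j then 1 else 0 :: real) = 1"
      by (rule eventually_sequentiallyI[of "nat \<bar>m $ j\<bar>"]) auto
    then show "(\<lambda>t. if 0 \<le> int t + m $ j then 1 else 0 :: real) \<longlonglongrightarrow> 1"
      by (rule tendsto_eventually)
  qed
  moreover have "(\<Prod>j\<in>(UNIV::'d set). if 0 \<le> int (k $ j) + m $ j then 1 else 0 :: real) =
      1 - (if \<forall>j. 0 \<le> int_vec k $ j + m $ j then 0 else 1)" for k :: "nat ^ 'd"
    by (auto simp: int_vec_def)
  ultimately have "((\<lambda>n. 1 - box_avg (\<lambda>k. if \<forall>j. 0 \<le> int_vec k $ j + m $ j then 0 else 1 :: real) n) \<longlongrightarrow> 1) at_top"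
    by (simp add: box_avg_diff[abs_def])
  from tendsto_diff[OF tendsto_const[of 1] this] show ?thesis by simp
qed

definition abs_vec :: "int ^ 'd \<Rightarrow> nat ^ 'd" where
  "abs_vec m = (\<chi> j. nat \<bar>m $ j\<bar>)"

text \<open>Where the shift by \<open>m\<close> stays in the orthant it is injective and maps the
  box of \<open>n\<close> into that of \<open>n + abs_vec m\<close>. Renormalising to the larger box
  costs the constant factor.\<close>

lemma box_avg_shift_le:
  fixes h :: "nat ^ 'd \<Rightarrow> real"
  assumes "\<And>k. h k \<ge> 0"
  shows "box_avg (\<lambda>k. if \<forall>j. 0 \<le> int_vec k $ j + m $ j then h (\<chi> j. nat (int_vec k $ j + m $ j)) else 0) n
    \<le> real (box_size (abs_vec m)) * box_avg h (n + abs_vec m)"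
proof -
  let ?I = "{k \<in> {0..n}. \<forall>j. 0 \<le> int_vec k $ j + m $ j}"
  let ?s = "\<lambda>k. \<chi> j. nat (int_vec k $ j + m $ j)"
  have "inj_on ?s ?I"
    by (auto simp: inj_on_def vec_eq_iff int_vec_def)
       (smt (verit, best) int_nat_eq nat_int)
  then have "(\<Sum>k\<in>?I. h (?s k)) = sum h (?s ` ?I)"
    by (simp add: sum.reindex)
  also have "\<dots> \<le> sum h {0..n + abs_vec m}"
  proof (rule sum_mono2)
    show "?s ` ?I \<subseteq> {0..n + abs_vec m}"
    proof (safe, goal_cases)
      case (1 x k)
      have "nat (int_vec k $ j + m $ j) \<le> n $ j + nat \<bar>m $ j\<bar>" for j
      proof -
        have "k $ j \<le> n $ j" using 1 by (simp add: less_eq_vec_def)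
        then show ?thesis by (simp add: int_vec_def)
      qed
      then show ?case by (simp add: less_eq_vec_def abs_vec_def)
    qed
  qed (use assms in auto)
  finally have le: "(\<Sum>k\<in>?I. h (?s k)) \<le> sum h {0..n + abs_vec m}" .
  \<comment> \<open>In each coordinate \<open>n + p + 1 \<le> (p + 1) * (n + 1)\<close>, with
    \<open>p\<close> the entry of \<open>abs_vec m\<close>.\<close>
  have "box_size (n + abs_vec m) \<le> box_size (abs_vec m) * box_size n"
    unfolding box_size_def prod.distrib[symmetric] by (intro prod_mono) auto
  then have size: "real (box_size (n + abs_vec m)) \<le> real (box_size (abs_vec m)) * real (box_size n)"
    by (metis of_nat_le_iff of_nat_mult)
  have "box_avg (\<lambda>k. if \<forall>j. 0 \<le> int_vec k $ j + m $ j then h (?s k) else 0) n = (\<Sum>k\<in>?I. h (?s k)) / box_size n"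
    unfolding box_avg_def by (subst sum.inter_filter) auto
  also have "\<dots> \<le> sum h {0..n + abs_vec m} / box_size n"
    by (intro divide_right_mono le) simp
  also have "\<dots> \<le> sum h {0..n + abs_vec m} * (box_size (abs_vec m) / box_size (n + abs_vec m))"
    unfolding divide_inverse using size
    by (intro mult_left_mono sum_nonneg assms) (auto simp: field_simps)
  finally show ?thesis by (simp add: box_avg_def mult.commute)
qed

lemma filterlim_add_multi_index: "filterlim (\<lambda>n :: nat ^ 'd. n + M) at_top at_top"
  unfolding filterlim_iff eventually_at_top_multi_index
  by (metis trans_less_add1 vector_add_component)

lemma norm_trig_sum_le:
  assumes "F \<subseteq> torus"
  shows "norm (trig_sum F c k) \<le> (\<Sum>w\<in>F. norm (c w))"
  unfolding trig_sum_def
  by (rule sum_norm_le) (use assms in \<open>auto simp: norm_mult norm_mpow\<close>)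

text \<open>Where the shifted index stays in the orthant, the error is an old error, controlled by
  \<open>box_avg_shift_le\<close>. Elsewhere the extension is 0 and the error is at most the bound
  \<open>B\<close> of the trigonometric sum, on a set of density zero; this accounts for the summand
  1 in the constant.\<close>

lemma shift_close_trig_sum:
  fixes a :: "nat ^ 'd \<Rightarrow> complex"
  assumes F: "F \<subseteq> torus" and "e > 0"
    and close: "\<forall>\<^sub>F n in at_top. box_avg (\<lambda>k. norm (a k - trig_sum F c (int_vec k))) n < e"
  shows "\<forall>\<^sub>F n in at_top. box_avg (\<lambda>k. norm (zero_ext a (int_vec k + m) - trig_sum F c (int_vec k + m))) n
    < (real (box_size (abs_vec m)) + 1) * e"
proof -
  define B where "B = (\<Sum>w\<in>F. norm (c w))"
  have B: "norm (trig_sum F c k) \<le> B" for k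
    unfolding B_def by (rule norm_trig_sum_le[OF F])
  define h where "h = (\<lambda>k. norm (a k - trig_sum F c (int_vec k)))"
  let ?ok = "\<lambda>k. \<forall>j. 0 \<le> int_vec k $ j + m $ j"
  have pt: "norm (zero_ext a (int_vec k + m) - trig_sum F c (int_vec k + m))
      \<le> (if ?ok k then h (\<chi> j. nat (int_vec k $ j + m $ j)) else 0) + B * (if ?ok k then 0 else 1)" for k
  proof (cases "?ok k")
    case True
    then have "int_vec (\<chi> j. nat (int_vec k $ j + m $ j)) = int_vec k + m"
      by (auto simp: int_vec_def vec_eq_iff)
    with True show ?thesis by (simp add: h_def zero_ext_def)
  next
    case False
    then have "zero_ext a (int_vec k + m) = 0"
      unfolding zero_ext_def by (metis vector_add_component)
    then show ?thesis using False B by auto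
  qed
  have 1: "\<forall>\<^sub>F n in at_top. box_avg h (n + abs_vec m) < e"
    using filterlim_add_multi_index close unfolding filterlim_iff h_def by blast
  have "((\<lambda>n. B * box_avg (\<lambda>k. if ?ok k then 0 else 1 :: real) n) \<longlongrightarrow> B * 0) at_top"
    by (intro tendsto_mult tendsto_const density_shifted_out_of_orthant)
  then have 2: "\<forall>\<^sub>F n in at_top. B * box_avg (\<lambda>k. if ?ok k then 0 else 1 :: real) n < e"
    using \<open>e > 0\<close> by (auto intro: order_tendstoD)
  show ?thesis
    using 1 2
  proof eventually_elim
    case (elim n)
    have "box_avg (\<lambda>k. norm (zero_ext a (int_vec k + m) - trig_sum F c (int_vec k + m))) n
      \<le> box_avg (\<lambda>k. (if ?ok k then h (\<chi> j. nat (int_vec k $ j + m $ j)) else 0) + B * (if ?ok k then 0 else 1)) n"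
      by (rule box_avg_mono[OF pt])
    also have "\<dots> \<le> real (box_size (abs_vec m)) * box_avg h (n + abs_vec m) + B * box_avg (\<lambda>k. if ?ok k then 0 else 1 :: real) n"
      unfolding box_avg_add box_avg_cmult
      by (intro add_mono box_avg_shift_le) (auto simp: h_def)
    also have "\<dots> < real (box_size (abs_vec m)) * e + e"
      using elim by (intro add_le_less_mono mult_left_mono) auto
    finally show ?case by (simp add: algebra_simps)
  qed
qed

subsection \<open>Approximation by trigonometric polynomials\<close>

text \<open>Since \<open>w\<close> need not be injective, indices with the same frequency are merged
  and their coefficients added.\<close>

lemma sum_mpow_eq_trig_sum:
  assumes "finite I"
  shows "(\<Sum>i\<in>I. c i * mpow (w i) k) = trig_sum (w ` I) (\<lambda>v. \<Sum>i\<in>{i\<in>I. w i = v}. c i) k"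
  unfolding trig_sum_def sum_distrib_right
  by (subst sum.image_gen[OF assms, of _ w]) (auto intro!: sum.cong)

lemma trig_poly_iff_trig_sum:
  "trig_poly P \<longleftrightarrow> (\<exists>F c. finite F \<and> F \<subseteq> torus \<and> P = (\<lambda>k. trig_sum F c (int_vec k)))"
proof
  assume "trig_poly P"
  then obtain r c w where rcw: "\<And>i. i < (r::nat) \<Longrightarrow> w i \<in> torus"
    "P = (\<lambda>k. \<Sum>i<r. c i * mpow (w i) (int_vec k))"
    by (auto simp: trig_poly_def)
  then show "\<exists>F c. finite F \<and> F \<subseteq> torus \<and> P = (\<lambda>k. trig_sum F c (int_vec k))"
    using rcw(1) unfolding rcw(2) sum_mpow_eq_trig_sum[OF finite_lessThan]
    by (intro exI[of _ "w ` {..<r}"] exI conjI) auto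
next
  assume "\<exists>F c. finite F \<and> F \<subseteq> torus \<and> P = (\<lambda>k. trig_sum F c (int_vec k))"
  then obtain F c where F: "finite F" "F \<subseteq> torus" "P = (\<lambda>k. trig_sum F c (int_vec k))" by blast
  from F(1) obtain w and r :: nat where w: "F = w ` {i. i < r}" "inj_on w {i. i < r}"
    by (rule finite_imp_nat_seg_image_inj_on[THEN exE]) blast
  have "P = (\<lambda>k. \<Sum>i<r. c (w i) * mpow (w i) (int_vec k))"
    unfolding F(3) trig_sum_def w(1) by (simp add: sum.reindex[OF w(2)] lessThan_def)
  then show "trig_poly P"
    unfolding trig_poly_def using F(2) w(1) by (intro exI[of _ r] exI[of _ "\<lambda>i. c (w i)"] exI[of _ w]) auto
qed

lemma trig_poly_const: "trig_poly (\<lambda>_. c)"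
  unfolding trig_poly_iff_trig_sum
  by (intro exI[of _ "{1}"] exI[of _ "\<lambda>_. c"]) (auto simp: trig_sum_def torus_def mpow_def)

lemma trig_poly_sum:
  assumes "finite I" "\<And>i. i \<in> I \<Longrightarrow> w i \<in> torus"
  shows "trig_poly (\<lambda>k. \<Sum>i\<in>I. c i * mpow (w i) (int_vec k))"
  unfolding trig_poly_iff_trig_sum sum_mpow_eq_trig_sum[OF assms(1)]
  using assms by (intro exI[of _ "w ` I"] exI conjI) auto

lemma trig_poly_add:
  assumes "trig_poly P" "trig_poly Q"
  shows "trig_poly (\<lambda>k. P k + Q k)"
proof -
  obtain F c G e where *: "finite F" "F \<subseteq> torus" "P = (\<lambda>k. trig_sum F c (int_vec k))"
    "finite G" "G \<subseteq> torus" "Q = (\<lambda>k. trig_sum G e (int_vec k))"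
    using assms unfolding trig_poly_iff_trig_sum by blast
  have "P k + Q k = (\<Sum>i\<in>F <+> G. case_sum c e i * mpow (case_sum id id i) (int_vec k))" for k
    using * by (simp add: sum.Plus trig_sum_def)
  moreover have "case_sum id id i \<in> torus" if "i \<in> F <+> G" for i
    using that * by auto
  ultimately show ?thesis
    using trig_poly_sum[of "F <+> G" "case_sum id id" "case_sum c e"] * by simp
qed

lemma trig_poly_mult:
  assumes "trig_poly P" "trig_poly Q"
  shows "trig_poly (\<lambda>k. P k * Q k)"
proof -
  obtain F c G e where *: "finite F" "F \<subseteq> torus" "P = (\<lambda>k. trig_sum F c (int_vec k))"
    "finite G" "G \<subseteq> torus" "Q = (\<lambda>k. trig_sum G e (int_vec k))"
    using assms unfolding trig_poly_iff_trig_sum by blast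
  have "P k * Q k = (\<Sum>i\<in>F \<times> G. (c (fst i) * e (snd i)) * mpow (fst i * snd i) (int_vec k))" for k
    using * by (simp add: sum_product trig_sum_def sum.cartesian_product mpow_int_vec power_mult_distrib
      prod.distrib case_prod_unfold mult_ac)
  then show ?thesis
    using trig_poly_sum[of "F \<times> G" "\<lambda>i. fst i * snd i" "\<lambda>i. c (fst i) * e (snd i)"] *
    by (auto simp: torus_def norm_mult subset_iff)
qed

lemma trig_poly_cnj:
  assumes "trig_poly P"
  shows "trig_poly (\<lambda>k. cnj (P k))"
proof -
  obtain F c where *: "finite F" "F \<subseteq> torus" "P = (\<lambda>k. trig_sum F c (int_vec k))"
    using assms unfolding trig_poly_iff_trig_sum by blast
  have "cnj (P k) = (\<Sum>w\<in>F. cnj (c w) * mpow (\<chi> j. cnj (w $ j)) (int_vec k))" for k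
    using * by (simp add: trig_sum_def mpow_int_vec)
  then show ?thesis
    using trig_poly_sum[of F "\<lambda>w. \<chi> j. cnj (w $ j)" "\<lambda>w. cnj (c w)"] *
    by (auto simp: torus_def subset_iff)
qed

text \<open>Trigonometric polynomials form an algebra closed under conjugation, so induction over
  the build-up of \<open>f\<close> reduces the claim to linear functionals.\<close>

lemma trig_poly_real_polynomial:
  assumes "real_polynomial_function f" "trig_poly P"
  shows "trig_poly (\<lambda>k. of_real (f (P k)))"
  using assms(1)
proof induction
  case (linear f)
  then interpret bounded_linear f .
  \<comment> \<open>A real-linear functional is determined by its values at 1 and
    \<open>\<i>\<close>; real and imaginary parts are then expressed through \<open>P k\<close> and
    its conjugate.\<close>
  have f: "f z = Re z * f 1 + Im z * f \<i>" for z
  proof -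
    have "z = Re z *\<^sub>R 1 + Im z *\<^sub>R \<i>" by (simp add: complex_eq_iff)
    then have "f z = f (Re z *\<^sub>R 1 + Im z *\<^sub>R \<i>)" by simp
    then show ?thesis by (simp add: add scale)
  qed
  have "of_real (f (P k)) = (P k + cnj (P k)) * of_real (f 1 / 2) +
      (P k + (-1) * cnj (P k)) * (of_real (f \<i>) / (2 * \<i>))" for k
    by (subst f) (simp add: complex_eq_iff)
  then show ?case
    by (simp only:) (intro trig_poly_add trig_poly_mult trig_poly_cnj trig_poly_const assms(2))
next
  case (const c)
  show ?case by (rule trig_poly_const)
next
  case (add f g)
  then show ?case by (simp add: trig_poly_add)
next
  case (mult f g)
  then show ?case by (simp add: trig_poly_mult)
qed

lemma trig_poly_polynomial:
  assumes "polynomial_function g" "trig_poly P"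
  shows "trig_poly (\<lambda>k. g (P k))"
proof -
  have "real_polynomial_function (Re \<circ> g)" "real_polynomial_function (Im \<circ> g)"
    using assms(1) bounded_linear_Re bounded_linear_Im by (auto simp: polynomial_function_def)
  then have "trig_poly (\<lambda>k. of_real ((Re \<circ> g) (P k)) + \<i> * of_real ((Im \<circ> g) (P k)))"
    by (intro trig_poly_add trig_poly_mult trig_poly_const trig_poly_real_polynomial assms(2))
  then show ?thesis by (simp flip: complex_eq)
qed

lemma bounded_trig_poly:
  assumes "trig_poly P"
  shows "bounded (range P)"
proof -
  obtain F c where *: "F \<subseteq> torus" "P = (\<lambda>k. trig_sum F c (int_vec k))"
    using assms unfolding trig_poly_iff_trig_sum by blast
  then have "norm (P k) \<le> (\<Sum>w\<in>F. norm (c w))" for k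
    by (simp add: norm_trig_sum_le)
  then show ?thesis by (auto simp: bounded_iff)
qed

text \<open>
  Composing an approximant with the retraction onto the disc, and then with a polynomial that is
  close to this retraction, gives approximants bounded by a constant independent of the
  accuracy. This upgrades approximation in mean to approximation in quadratic mean.
\<close>

lemma besicovitch_1_bounded_approximant:
  fixes a :: "nat ^ 'd \<Rightarrow> complex"
  assumes "a \<in> besicovitch_1" "\<And>k. norm (a k) \<le> C" "e > 0"
  obtains P where "trig_poly P" "\<And>k. norm (P k) \<le> C + e"
    "\<forall>\<^sub>F n in at_top. box_avg (\<lambda>k. norm (a k - P k)) n < e"
proof -
  have "C \<ge> 0" using assms(2)[of 0] norm_ge_zero order_trans by blast
  obtain P where P: "trig_poly P"
    "Limsup at_top (\<lambda>n. ereal (box_avg (\<lambda>k. norm (a k - P k)) n)) < ereal (e / 2)"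
    using assms(1,3) by (auto simp: besicovitch_1_def box_avg_def dest!: spec[of _ "e/2"])
  obtain R where R: "\<And>k. norm (P k) \<le> R"
    using bounded_trig_poly[OF P(1)] by (auto simp: bounded_iff)
  let ?T = "closest_point (cball (0::complex) C)"
  have T: "closed (cball (0::complex) C)" "convex (cball (0::complex) C)" "cball (0::complex) C \<noteq> {}"
    using \<open>C \<ge> 0\<close> by auto
  obtain g where g: "polynomial_function g" "\<And>z. z \<in> cball 0 R \<Longrightarrow> norm (?T z - g z) < e / 2"
    using Stone_Weierstrass_polynomial_function[OF compact_cball[of 0 R] continuous_on_closest_point[OF T(2,1,3)], of "e/2"] assms(3)
    by auto
  have gP: "norm (?T (P k) - g (P k)) < e / 2" for k
    using R by (intro g) auto
  show thesis
  proof
    show "trig_poly (\<lambda>k. g (P k))" by (rule trig_poly_polynomial[OF g(1) P(1)])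
    show "norm (g (P k)) \<le> C + e" for k
    proof -
      have "norm (?T (P k)) \<le> C"
        using closest_point_in_set[OF T(1,3), of "P k"] by simp
      then show ?thesis using gP[of k] norm_triangle_ineq3[of "?T (P k)" "g (P k)"] \<open>e > 0\<close> by linarith
    qed
    have pt: "norm (a k - g (P k)) \<le> norm (a k - P k) + e / 2" for k
    proof -
      \<comment> \<open>\<open>?T\<close> fixes \<open>a k\<close> and is 1-Lipschitz, so retracting
        \<open>P k\<close> does not increase its distance from \<open>a k\<close>.\<close>
      have "?T (a k) = a k" using assms(2) by (intro closest_point_self) simp
      then have "norm (a k - ?T (P k)) \<le> norm (a k - P k)"
        using closest_point_lipschitz[OF T(2,1,3), of "a k" "P k"] by (simp add: dist_norm)
      then show ?thesis using gP[of k] norm_triangle_ineq[of "a k - ?T (P k)" "?T (P k) - g (P k)"] by simp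
    qed
    show "\<forall>\<^sub>F n in at_top. box_avg (\<lambda>k. norm (a k - g (P k))) n < e"
      using Limsup_lessD[OF P(2)]
    proof eventually_elim
      case (elim n)
      have "box_avg (\<lambda>k. norm (a k - g (P k))) n \<le> box_avg (\<lambda>k. norm (a k - P k) + e / 2) n"
        by (rule box_avg_mono[OF pt])
      also have "\<dots> < e" using elim by (simp add: box_avg_add)
      finally show ?case .
    qed
  qed
qed

lemma box_avg_approx_mult:
  assumes "\<And>k. norm (f k) \<le> C"
  shows "norm (box_avg (\<lambda>k. f k * g k) n - box_avg (\<lambda>k. f k * h k) n) \<le> C * box_avg (\<lambda>k. norm (g k - h k)) n"
proof -
  have "norm (box_avg (\<lambda>k. f k * g k) n - box_avg (\<lambda>k. f k * h k) n) = norm (box_avg (\<lambda>k. f k * (g k - h k)) n)"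
    by (simp add: box_avg_diff[symmetric] right_diff_distrib)
  also have "\<dots> \<le> box_avg (\<lambda>k. norm (f k * (g k - h k))) n" by (rule norm_box_avg_le)
  also have "\<dots> \<le> box_avg (\<lambda>k. C * norm (g k - h k)) n"
    by (intro box_avg_mono) (auto simp: norm_mult assms mult_right_mono)
  finally show ?thesis by (simp add: box_avg_cmult)
qed

subsection \<open>Fourier coefficients and Parseval's formula\<close>

definition has_fourier_coeffs :: "(nat ^ 'd \<Rightarrow> complex) \<Rightarrow> (complex ^ 'd \<Rightarrow> complex) \<Rightarrow> bool" where
  "has_fourier_coeffs a A \<longleftrightarrow>
     (\<forall>w\<in>torus. (box_avg (\<lambda>k. a k * cnj (mpow w (int_vec k))) \<longlongrightarrow> A w) at_top)"

lemma tendsto_box_avg_trig_sum_cnj: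
  assumes "F \<subseteq> torus" "w \<in> torus" "finite F"
  shows "(box_avg (\<lambda>k. trig_sum F c (int_vec k) * cnj (mpow w (int_vec k))) \<longlongrightarrow> (if w \<in> F then c w else 0)) at_top"
proof -
  have "((\<lambda>n. \<Sum>v\<in>F. c v * box_avg (\<lambda>k. mpow v (int_vec k) * cnj (mpow w (int_vec k))) n) \<longlongrightarrow>
     (\<Sum>v\<in>F. c v * (if v = w then 1 else 0))) at_top"
    using assms by (intro tendsto_sum tendsto_mult tendsto_const box_avg_mpow_cnj) auto
  moreover have "(\<Sum>v\<in>F. c v * box_avg (\<lambda>k. mpow v (int_vec k) * cnj (mpow w (int_vec k))) n) =
     box_avg (\<lambda>k. trig_sum F c (int_vec k) * cnj (mpow w (int_vec k))) n" for n
    by (simp add: trig_sum_def sum_distrib_right box_avg_sum box_avg_cmult mult.assoc)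
  moreover have "(\<Sum>v\<in>F. c v * (if v = w then 1 else 0)) = (if w \<in> F then c w else 0)"
    using assms(3) by (simp add: if_distrib cong: if_cong)
  ultimately show ?thesis by simp
qed

text \<open>For trigonometric sums the means converge by orthogonality. As characters have modulus
  1, replacing \<open>a\<close> by an approximant \<open>P\<close> changes a mean by at most the
  mean of \<open>norm (a k - P k)\<close>.\<close>

lemma besicovitch_1_has_fourier_coeffs:
  fixes a :: "nat ^ 'd \<Rightarrow> complex"
  assumes "a \<in> besicovitch_1" "\<And>k. norm (a k) \<le> C"
  shows "\<exists>A. has_fourier_coeffs a A"
proof -
  have "\<exists>l. (box_avg (\<lambda>k. a k * cnj (mpow w (int_vec k))) \<longlongrightarrow> l) at_top" if w: "w \<in> torus" for w
  proof (rule tendsto_if_approximable)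
    fix e :: real assume "e > 0"
    then obtain P where P: "trig_poly P" "\<forall>\<^sub>F n in at_top. box_avg (\<lambda>k. norm (a k - P k)) n < e"
      using besicovitch_1_bounded_approximant[OF assms] by metis
    then obtain F c where F: "finite F" "F \<subseteq> torus" "P = (\<lambda>k. trig_sum F c (int_vec k))"
      unfolding trig_poly_iff_trig_sum by blast
    show "\<exists>v l. (v \<longlongrightarrow> l) at_top \<and>
      (\<forall>\<^sub>F n in at_top. dist (box_avg (\<lambda>k. a k * cnj (mpow w (int_vec k))) n) (v n) < e)"
    proof (intro exI conjI)
      show "(box_avg (\<lambda>k. P k * cnj (mpow w (int_vec k))) \<longlongrightarrow> (if w \<in> F then c w else 0)) at_top"
        unfolding F(3) by (intro tendsto_box_avg_trig_sum_cnj F w)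
      show "\<forall>\<^sub>F n in at_top. dist (box_avg (\<lambda>k. a k * cnj (mpow w (int_vec k))) n)
          (box_avg (\<lambda>k. P k * cnj (mpow w (int_vec k))) n) < e"
        using P(2)
      proof eventually_elim
        case (elim n)
        then show ?case
          using box_avg_approx_mult[of "\<lambda>k. cnj (mpow w (int_vec k))" 1 a n P] norm_mpow[OF w]
          by (simp add: dist_norm mult.commute)
      qed
    qed
  qed
  then show ?thesis unfolding has_fourier_coeffs_def by metis
qed

lemma has_fourier_coeffs_trig_sum:
  assumes "finite F" "F \<subseteq> torus"
  shows "has_fourier_coeffs (\<lambda>k. trig_sum F c (int_vec k)) (\<lambda>w. if w \<in> F then c w else 0)"
  unfolding has_fourier_coeffs_def using tendsto_box_avg_trig_sum_cnj[OF assms(2) _ assms(1)] by blast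

lemma trig_sum_shift:
  assumes "F \<subseteq> torus"
  shows "trig_sum F c (k + m) = trig_sum F (\<lambda>w. c w * mpow w m) k"
  unfolding trig_sum_def by (intro sum.cong) (use assms in \<open>auto simp: mpow_add\<close>)

lemma tendsto_box_avg_mult_cnj_trig_sum:
  assumes "has_fourier_coeffs a A" "F \<subseteq> torus"
  shows "(box_avg (\<lambda>k. a k * cnj (trig_sum F c (int_vec k))) \<longlongrightarrow> (\<Sum>w\<in>F. A w * cnj (c w))) at_top"
proof -
  have "((\<lambda>n. \<Sum>w\<in>F. cnj (c w) * box_avg (\<lambda>k. a k * cnj (mpow w (int_vec k))) n) \<longlongrightarrow>
     (\<Sum>w\<in>F. cnj (c w) * A w)) at_top"
    using assms by (intro tendsto_sum tendsto_mult tendsto_const) (auto simp: has_fourier_coeffs_def)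
  moreover have "(\<Sum>w\<in>F. cnj (c w) * box_avg (\<lambda>k. a k * cnj (mpow w (int_vec k))) n) =
     box_avg (\<lambda>k. a k * cnj (trig_sum F c (int_vec k))) n" for n
    by (simp add: trig_sum_def sum_distrib_left box_avg_sum box_avg_cmult[symmetric] mult_ac)
  ultimately show ?thesis by (simp add: mult.commute)
qed

text \<open>Shifting a trigonometric sum merely multiplies the coefficient at \<open>w\<close> by
  \<open>mpow w m\<close>, so the conjugate of the preceding limit applies.\<close>

lemma tendsto_box_avg_cnj_mult_shifted_trig_sum:
  assumes "has_fourier_coeffs a A" "F \<subseteq> torus"
  shows "(box_avg (\<lambda>k. cnj (a k) * trig_sum F c (int_vec k + m)) \<longlongrightarrow> (\<Sum>w\<in>F. cnj (A w) * c w * mpow w m)) at_top"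
proof -
  have "(box_avg (\<lambda>k. cnj (a k * cnj (trig_sum F (\<lambda>w. c w * mpow w m) (int_vec k)))) \<longlongrightarrow>
      cnj (\<Sum>w\<in>F. A w * cnj (c w * mpow w m))) at_top"
    unfolding box_avg_cnj by (intro tendsto_cnj tendsto_box_avg_mult_cnj_trig_sum assms)
  then show ?thesis by (simp add: trig_sum_shift[OF assms(2)] mult.assoc)
qed

text \<open>Only the second factor of the correlation is approximated: the mean of the bounded first
  factor against a shifted trigonometric sum converges, and \<open>shift_close_trig_sum\<close>
  controls the error.\<close>

lemma besicovitch_1_in_class_S:
  fixes a :: "nat ^ 'd \<Rightarrow> complex"
  assumes a: "a \<in> besicovitch_1" "\<And>k. norm (a k) \<le> C"
  shows "a \<in> class_S"
proof -
  obtain A where A: "has_fourier_coeffs a A"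
    using besicovitch_1_has_fourier_coeffs[OF a] by blast
  have "C \<ge> 0" using a(2)[of 0] norm_ge_zero order_trans by blast
  have "\<exists>l. (correlation_avg a m \<longlongrightarrow> l) at_top" for m
  proof (rule tendsto_if_approximable)
    fix e :: real assume "e > 0"
    \<comment> \<open>\<open>C\<close> bounds the first factor and the rest comes from the shift
      estimate; \<open>C + 1\<close> keeps \<open>K\<close> positive when
      \<open>C = 0\<close>.\<close>
    define K where "K = (C + 1) * (real (box_size (abs_vec m)) + 1)"
    have "K > 0" unfolding K_def using \<open>C \<ge> 0\<close> by (intro mult_pos_pos) auto
    obtain P where P: "trig_poly P" "\<forall>\<^sub>F n in at_top. box_avg (\<lambda>k. norm (a k - P k)) n < e / K"
      using besicovitch_1_bounded_approximant[OF a, of "e / K"] \<open>e > 0\<close> \<open>K > 0\<close> by (metis divide_pos_pos)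
    then obtain F c where F: "finite F" "F \<subseteq> torus" "P = (\<lambda>k. trig_sum F c (int_vec k))"
      unfolding trig_poly_iff_trig_sum by blast
    show "\<exists>v l. (v \<longlongrightarrow> l) at_top \<and> (\<forall>\<^sub>F n in at_top. dist (correlation_avg a m n) (v n) < e)"
    proof (intro exI conjI)
      show "(box_avg (\<lambda>k. cnj (a k) * trig_sum F c (int_vec k + m)) \<longlongrightarrow> (\<Sum>w\<in>F. cnj (A w) * c w * mpow w m)) at_top"
        by (intro tendsto_box_avg_cnj_mult_shifted_trig_sum A F)
      have "\<forall>\<^sub>F n in at_top. box_avg (\<lambda>k. norm (zero_ext a (int_vec k + m) - trig_sum F c (int_vec k + m))) n
        < (real (box_size (abs_vec m)) + 1) * (e / K)"
        using P(2) \<open>e > 0\<close> \<open>K > 0\<close> unfolding F(3) by (intro shift_close_trig_sum F) auto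
      then show "\<forall>\<^sub>F n in at_top. dist (correlation_avg a m n)
          (box_avg (\<lambda>k. cnj (a k) * trig_sum F c (int_vec k + m)) n) < e"
      proof eventually_elim
        case (elim n)
        let ?x = "box_avg (\<lambda>k. norm (zero_ext a (int_vec k + m) - trig_sum F c (int_vec k + m))) n"
        have "dist (correlation_avg a m n) (box_avg (\<lambda>k. cnj (a k) * trig_sum F c (int_vec k + m)) n) \<le> C * ?x"
          unfolding correlation_avg_eq_box_avg dist_norm by (intro box_avg_approx_mult) (simp add: a)
        also have "\<dots> \<le> (C + 1) * ?x"
          using order_trans[OF norm_ge_zero norm_box_avg_le] by (intro mult_right_mono) auto
        also have "\<dots> < (C + 1) * ((real (box_size (abs_vec m)) + 1) * (e / K))"
          using elim \<open>C \<ge> 0\<close> by (intro mult_strict_left_mono) auto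
        also have "\<dots> = K * (e / K)" by (simp add: K_def)
        also have "\<dots> = e" using \<open>K > 0\<close> by simp
        finally show ?case .
      qed
    qed
  qed
  then show ?thesis by (auto simp: class_S_def)
qed

section \<open>Least squares and the Parseval formula for correlations\<close>

lemma box_avg_Re: "box_avg (\<lambda>k. Re (f k)) n = Re (box_avg f n)"
  by (simp add: box_avg_def Re_divide_of_nat)

text \<open>Completing the square in each coefficient splits the limit into a part independent of
  \<open>c\<close> and a part that vanishes for \<open>c = A\<close>. So the Fourier coefficients
  are the best choice on \<open>F\<close>.\<close>

lemma tendsto_box_avg_square_dist_trig_sum:
  assumes A: "has_fourier_coeffs a A" and F: "finite F" "F \<subseteq> torus"
    and g: "(box_avg (\<lambda>k. (norm (a k))\<^sup>2) \<longlongrightarrow> g) at_top"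
  shows "(box_avg (\<lambda>k. (norm (a k - trig_sum F c (int_vec k)))\<^sup>2) \<longlongrightarrow>
    g - (\<Sum>w\<in>F. (norm (A w))\<^sup>2) + (\<Sum>w\<in>F. (norm (A w - c w))\<^sup>2)) at_top"
proof -
  let ?y = "\<lambda>k. trig_sum F c (int_vec k)"
  \<comment> \<open>This identity serves twice: for the values of the sequences, and for the
    coefficients \<open>A w\<close> and \<open>c w\<close>.\<close>
  have expand: "(norm (x - y))\<^sup>2 = (norm x)\<^sup>2 + (Re (y * cnj y) - 2 * Re (x * cnj y))" for x y :: complex
    unfolding cmod_power2 by (simp add: power2_eq_square algebra_simps)
  have eq: "box_avg (\<lambda>k. (norm (a k - ?y k))\<^sup>2) n = box_avg (\<lambda>k. (norm (a k))\<^sup>2) n +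
      (Re (box_avg (\<lambda>k. ?y k * cnj (?y k)) n) - 2 * Re (box_avg (\<lambda>k. a k * cnj (?y k)) n))" for n
    unfolding expand box_avg_add box_avg_diff box_avg_cmult box_avg_Re ..
  have "((\<lambda>n. box_avg (\<lambda>k. (norm (a k))\<^sup>2) n +
      (Re (box_avg (\<lambda>k. ?y k * cnj (?y k)) n) - 2 * Re (box_avg (\<lambda>k. a k * cnj (?y k)) n))) \<longlongrightarrow>
      g + (Re (\<Sum>w\<in>F. (if w \<in> F then c w else 0) * cnj (c w)) - 2 * Re (\<Sum>w\<in>F. A w * cnj (c w)))) at_top"
    by (intro tendsto_intros g tendsto_box_avg_mult_cnj_trig_sum has_fourier_coeffs_trig_sum A F)
  moreover have "g + (Re (\<Sum>w\<in>F. (if w \<in> F then c w else 0) * cnj (c w)) - 2 * Re (\<Sum>w\<in>F. A w * cnj (c w))) =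
      g - (\<Sum>w\<in>F. (norm (A w))\<^sup>2) + (\<Sum>w\<in>F. (norm (A w - c w))\<^sup>2)"
    unfolding expand by (simp add: sum.distrib sum_subtractf sum_distrib_left)
  ultimately show ?thesis unfolding eq[abs_def] by (simp only:)
qed

lemma besicovitch_1_square_approximant:
  fixes a :: "nat ^ 'd \<Rightarrow> complex"
  assumes "a \<in> besicovitch_1" "\<And>k. norm (a k) \<le> C" "e > 0"
  obtains F c where "finite F" "F \<subseteq> torus"
    "\<forall>\<^sub>F n in at_top. box_avg (\<lambda>k. (norm (a k - trig_sum F c (int_vec k)))\<^sup>2) n < e"
proof -
  have "C \<ge> 0" using assms(2)[of 0] norm_ge_zero order_trans by blast
  \<comment> \<open>\<open>d \<le> 1\<close> bounds \<open>norm (a k - P k)\<close> by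
    \<open>2 * C + 1\<close>, so squaring costs at most this factor, which the second bound on
    \<open>d\<close> compensates.\<close>
  define d where "d = min 1 (e / (2 * C + 1))"
  have d: "d > 0" "d \<le> 1" using \<open>C \<ge> 0\<close> \<open>e > 0\<close> by (auto simp: d_def)
  have "d \<le> e / (2 * C + 1)" by (simp add: d_def)
  then have de: "(2 * C + 1) * d \<le> e" using \<open>C \<ge> 0\<close> by (simp add: pos_le_divide_eq mult.commute)
  obtain P where P: "trig_poly P" "\<And>k. norm (P k) \<le> C + d"
    "\<forall>\<^sub>F n in at_top. box_avg (\<lambda>k. norm (a k - P k)) n < d"
    using besicovitch_1_bounded_approximant[OF assms(1,2) d(1)] by metis
  obtain F c where F: "finite F" "F \<subseteq> torus" "P = (\<lambda>k. trig_sum F c (int_vec k))"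
    using P(1) unfolding trig_poly_iff_trig_sum by blast
  have pt: "(norm (a k - P k))\<^sup>2 \<le> (2 * C + 1) * norm (a k - P k)" for k
    using norm_triangle_ineq4[of "a k" "P k"] assms(2)[of k] P(2)[of k] d(2)
    unfolding power2_eq_square by (intro mult_right_mono) auto
  have "\<forall>\<^sub>F n in at_top. box_avg (\<lambda>k. (norm (a k - P k))\<^sup>2) n < e"
    using P(3)
  proof eventually_elim
    case (elim n)
    have "box_avg (\<lambda>k. (norm (a k - P k))\<^sup>2) n \<le> box_avg (\<lambda>k. (2 * C + 1) * norm (a k - P k)) n"
      by (rule box_avg_mono[OF pt])
    also have "\<dots> < (2 * C + 1) * d"
      unfolding box_avg_cmult using elim \<open>C \<ge> 0\<close> by (intro mult_strict_left_mono) auto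
    finally show ?case using de by simp
  qed
  then show thesis using that F by blast
qed

text \<open>Once the frequencies in \<open>F\<close> allow a good quadratic approximation, every
  finite \<open>G \<supseteq> F\<close> does so with the Fourier coefficients of \<open>a\<close>,
  since the residual only decreases. Pairing \<open>a\<close> with this sum shifted by
  \<open>m\<close> gives the partial sum over \<open>G\<close>, which is convergence along finite
  sets.\<close>

lemma besicovitch_1_correlation_has_sum:
  fixes a :: "nat ^ 'd \<Rightarrow> complex"
  assumes a: "a \<in> besicovitch_1" "\<And>k. norm (a k) \<le> C"
    and A: "has_fourier_coeffs a A"
    and m: "(correlation_avg a m \<longlongrightarrow> \<gamma>) at_top"
  shows "((\<lambda>w. of_real ((norm (A w))\<^sup>2) * mpow w m) has_sum \<gamma>) torus"
  unfolding has_sum_def tendsto_iff eventually_finite_subsets_at_top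
proof (intro allI impI)
  fix e :: real assume "e > 0"
  have "C \<ge> 0" using a(2)[of 0] norm_ge_zero order_trans by blast
  \<comment> \<open>The final error is \<open>(K - 1) * (2 * d)\<close>, where \<open>2 * d\<close>
    bounds the mean error; hence \<open>d = e / (2 * K)\<close>, and the added 1 makes the estimate
    strict.\<close>
  define K where "K = C * (real (box_size (abs_vec m)) + 1) + 1"
  have "K > 0" unfolding K_def using \<open>C \<ge> 0\<close> by (intro add_nonneg_pos mult_nonneg_nonneg) auto
  define d where "d = e / (2 * K)"
  have "d > 0" using \<open>e > 0\<close> \<open>K > 0\<close> by (simp add: d_def)
  \<comment> \<open>The correlation at 0 is the limit of the quadratic mean of \<open>a\<close>,
    needed for the least squares formula.\<close>
  obtain l where "(correlation_avg a 0 \<longlongrightarrow> l) at_top"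
    using besicovitch_1_in_class_S[OF a] by (auto simp: class_S_def)
  then have "((\<lambda>n. Re (correlation_avg a 0 n)) \<longlongrightarrow> Re l) at_top"
    by (rule tendsto_Re)
  moreover have "(\<lambda>n. Re (correlation_avg a 0 n)) = box_avg (\<lambda>k. (norm (a k))\<^sup>2)"
  proof
    show "Re (correlation_avg a 0 n) = box_avg (\<lambda>k. (norm (a k))\<^sup>2) n" for n
      unfolding correlation_avg_eq_box_avg box_avg_Re[symmetric] cmod_power2
      by (simp add: zero_ext_def int_vec_def power2_eq_square)
  qed
  ultimately have g: "(box_avg (\<lambda>k. (norm (a k))\<^sup>2) \<longlongrightarrow> Re l) at_top"
    by (simp only:)
  have "d\<^sup>2 / 2 > 0" using \<open>d > 0\<close> by simp
  obtain F c where F: "finite F" "F \<subseteq> torus"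
    "\<forall>\<^sub>F n in at_top. box_avg (\<lambda>k. (norm (a k - trig_sum F c (int_vec k)))\<^sup>2) n < d\<^sup>2 / 2"
    by (rule besicovitch_1_square_approximant[OF a \<open>d\<^sup>2 / 2 > 0\<close>])
  \<comment> \<open>The limit yields only a weak inequality, so \<open>F\<close> was chosen for
    \<open>d\<^sup>2 / 2\<close>; dropping the distance between \<open>A\<close> and
    \<open>c\<close> then leaves the residual below \<open>d\<^sup>2\<close>.\<close>
  have "Re l - (\<Sum>w\<in>F. (norm (A w))\<^sup>2) + (\<Sum>w\<in>F. (norm (A w - c w))\<^sup>2) \<le> d\<^sup>2 / 2"
    by (rule tendsto_upperbound[OF tendsto_box_avg_square_dist_trig_sum[OF A F(1,2) g]])
       (use F(3) in \<open>auto elim: eventually_mono\<close>)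
  moreover have "(\<Sum>w\<in>F. (norm (A w - c w))\<^sup>2) \<ge> 0" by (intro sum_nonneg) auto
  moreover have "d\<^sup>2 > 0" using \<open>d > 0\<close> by simp
  ultimately have resid: "Re l - (\<Sum>w\<in>F. (norm (A w))\<^sup>2) < d\<^sup>2" by linarith
  show "\<exists>X. finite X \<and> X \<subseteq> torus \<and> (\<forall>Y. finite Y \<and> X \<subseteq> Y \<and> Y \<subseteq> torus \<longrightarrow>
      dist (\<Sum>w\<in>Y. of_real ((norm (A w))\<^sup>2) * mpow w m) \<gamma> < e)"
  proof (intro exI[of _ F] conjI allI impI F)
    fix G assume "finite G \<and> F \<subseteq> G \<and> G \<subseteq> torus"
    then have G: "finite G" "F \<subseteq> G" "G \<subseteq> torus" by auto
    have "(\<Sum>w\<in>F. (norm (A w))\<^sup>2) \<le> (\<Sum>w\<in>G. (norm (A w))\<^sup>2)"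
      using G by (intro sum_mono2) auto
    \<comment> \<open>With the coefficients \<open>A\<close> themselves, the last sum vanishes and
      only the residual remains.\<close>
    then have "Re l - (\<Sum>w\<in>G. (norm (A w))\<^sup>2) + (\<Sum>w\<in>G. (norm (A w - A w))\<^sup>2) < d\<^sup>2"
      using resid by simp
    then have "\<forall>\<^sub>F n in at_top. box_avg (\<lambda>k. (norm (a k - trig_sum G A (int_vec k)))\<^sup>2) n < d\<^sup>2"
      by (rule order_tendstoD(2)[OF tendsto_box_avg_square_dist_trig_sum[OF A G(1,3) g]])
    then have "\<forall>\<^sub>F n in at_top. box_avg (\<lambda>k. norm (a k - trig_sum G A (int_vec k))) n < 2 * d"
    proof eventually_elim
      case (elim n)
      \<comment> \<open>In place of the Cauchy-Schwarz inequality, this turns a quadratic mean below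
        \<open>d\<^sup>2\<close> into a mean below \<open>2 * d\<close>.\<close>
      have pt: "t \<le> d + 1 / d * t\<^sup>2" if "t \<ge> 0" for t
      proof (cases "t \<le> d")
        case True then show ?thesis using \<open>d > 0\<close> that by (auto intro: add_increasing2)
      next
        case False
        then have "t * d \<le> t * t" using that by (intro mult_left_mono) auto
        then have "d * t \<le> d * d + t * t" using zero_le_square[of d] by (simp add: mult.commute add_increasing)
        then show ?thesis using \<open>d > 0\<close> by (simp add: field_simps power2_eq_square)
      qed
      have "box_avg (\<lambda>k. norm (a k - trig_sum G A (int_vec k))) n \<le>
          box_avg (\<lambda>k. d + 1 / d * (norm (a k - trig_sum G A (int_vec k)))\<^sup>2) n"
        by (intro box_avg_mono pt) auto
      also have "\<dots> = d + 1 / d * box_avg (\<lambda>k. (norm (a k - trig_sum G A (int_vec k)))\<^sup>2) n"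
        by (simp only: box_avg_add box_avg_cmult box_avg_const)
      also have "\<dots> < d + 1 / d * d\<^sup>2"
        using elim \<open>d > 0\<close> by (intro add_strict_left_mono mult_strict_left_mono) auto
      also have "\<dots> = 2 * d" using \<open>d > 0\<close> by (simp add: power2_eq_square)
      finally show ?case .
    qed
    then have "\<forall>\<^sub>F n in at_top. box_avg (\<lambda>k. norm (zero_ext a (int_vec k + m) - trig_sum G A (int_vec k + m))) n
        < (real (box_size (abs_vec m)) + 1) * (2 * d)"
      using \<open>d > 0\<close> by (intro shift_close_trig_sum G) auto
    then have "\<forall>\<^sub>F n in at_top. norm (correlation_avg a m n - box_avg (\<lambda>k. cnj (a k) * trig_sum G A (int_vec k + m)) n)
        \<le> C * ((real (box_size (abs_vec m)) + 1) * (2 * d))"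
    proof eventually_elim
      case (elim n)
      have "norm (correlation_avg a m n - box_avg (\<lambda>k. cnj (a k) * trig_sum G A (int_vec k + m)) n) \<le>
          C * box_avg (\<lambda>k. norm (zero_ext a (int_vec k + m) - trig_sum G A (int_vec k + m))) n"
        unfolding correlation_avg_eq_box_avg by (intro box_avg_approx_mult) (simp add: a)
      then show ?case using elim \<open>C \<ge> 0\<close> by (meson less_imp_le mult_left_mono order_trans)
    qed
    then have "norm (\<gamma> - (\<Sum>w\<in>G. cnj (A w) * A w * mpow w m)) \<le> C * ((real (box_size (abs_vec m)) + 1) * (2 * d))"
      by (rule tendsto_upperbound[OF tendsto_norm[OF tendsto_diff[OF m
          tendsto_box_avg_cnj_mult_shifted_trig_sum[OF A G(3)]]]]) simp
    also have "\<dots> = (K - 1) * (2 * d)" by (simp add: K_def)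
    also have "\<dots> < K * (2 * d)" using \<open>d > 0\<close> by simp
    also have "\<dots> = e" using \<open>K > 0\<close> by (simp add: d_def)
    finally show "dist (\<Sum>w\<in>G. of_real ((norm (A w))\<^sup>2) * mpow w m) \<gamma> < e"
      by (simp add: dist_norm norm_minus_commute complex_norm_square mult.commute del: of_real_power)
  qed
qed

subsection \<open>The spectral measure\<close>

lemma sets_torus: "torus \<in> sets (borel :: (complex ^ 'd) measure)"
proof -
  have "torus = (\<Inter>j. {z :: complex ^ 'd. norm (z $ j) = 1})"
    by (auto simp: torus_def)
  moreover have "closed \<dots>"
    by (intro closed_INT ballI closed_Collect_eq continuous_intros)
  ultimately show ?thesis by simp
qed

lemma borel_measurable_mpow: "(\<lambda>z. mpow z m) \<in> borel_measurable (restrict_space borel torus)"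
proof (rule borel_measurable_continuous_on_restrict)
  show "continuous_on torus (\<lambda>z. mpow z m)"
    unfolding mpow_def
    by (intro continuous_on_prod continuous_on_power_int continuous_intros)
       (metis (mono_tags) torus_def mem_Collect_eq norm_zero zero_neq_one)
qed

text \<open>The measure has mass \<open>p w\<close> at \<open>w\<close>. It is first formed on all
  subsets of the torus as a density against counting measure, so that integrals become sums.\<close>

lemma discrete_spectral_measureI:
  fixes a :: "nat ^ 'd \<Rightarrow> complex"
  assumes p: "\<And>w. p w \<ge> 0"
    and sum: "\<And>m. ((\<lambda>w. of_real (p w) * mpow w m) has_sum correlation a m) torus"
  shows "\<exists>\<sigma>. is_spectral_measure a \<sigma> \<and> discrete_measure \<sigma>"
proof -
  let ?T = "restrict_space borel (torus :: (complex ^ 'd) set)"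
  define D where "D = density (count_space torus) (\<lambda>w. ennreal (p w))"
  \<comment> \<open>The image under the identity only coarsens the sigma-algebra, from all subsets
    to the Borel sets.\<close>
  define \<sigma> where "\<sigma> = distr D ?T (\<lambda>w. w)"
  have [simp]: "torus \<in> sets ?T"
    using sets_torus by (auto simp: sets_restrict_space)
  have [measurable]: "(\<lambda>w. w) \<in> measurable D ?T"
    by (simp add: D_def measurable_def space_restrict_space)
  \<comment> \<open>At \<open>m = 0\<close> the characters equal 1, so the masses are summable;
    finiteness of the measure and countability of its atoms rest on this.\<close>
  have "(\<lambda>w. complex_of_real (p w)) summable_on torus"
    using sum[of 0] by (auto simp: summable_on_def)
  from summable_on_Re[OF this] have p_summable: "p summable_on torus" by simp
  then have p_sum: "Infinite_Set_Sum.abs_summable_on p torus"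
    using p by (subst abs_summable_equivalent[symmetric]) simp
  have emeasure: "emeasure \<sigma> B = (\<integral>\<^sup>+w\<in>B. ennreal (p w) \<partial>count_space torus)" if "B \<in> sets ?T" for B
  proof -
    have "B \<subseteq> torus" using sets.sets_into_space[OF that] by (simp add: space_restrict_space)
    then show ?thesis
      unfolding \<sigma>_def D_def using that
      by (subst emeasure_distr) (auto simp: emeasure_density measurable_def space_restrict_space Int_absorb2)
  qed
  have "is_spectral_measure a \<sigma>"
    unfolding is_spectral_measure_def
  proof (intro conjI allI)
    have "emeasure \<sigma> (space \<sigma>) = (\<integral>\<^sup>+w. ennreal (p w) \<partial>count_space torus)"
      unfolding \<sigma>_def D_def
      by (subst emeasure_distr) (auto simp: emeasure_density measurable_def space_restrict_space intro!: nn_integral_cong)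
    also have "\<dots> = ennreal (infsetsum p torus)"
      using p by (intro nn_integral_conv_infsetsum p_sum) auto
    finally show "finite_measure \<sigma>" by (intro finite_measureI) simp
    show "sets \<sigma> = sets ?T" by (simp add: \<sigma>_def)
    fix m
    have "(\<integral>z. mpow z m \<partial>\<sigma>) = (\<integral>z. mpow z m \<partial>D)"
      unfolding \<sigma>_def by (rule integral_distr) (simp_all add: borel_measurable_mpow)
    also have "\<dots> = infsetsum (\<lambda>w. of_real (p w) * mpow w m) torus"
      unfolding D_def infsetsum_def using p by (subst integral_density) (auto simp: scaleR_conv_of_real)
    also have "\<dots> = infsum (\<lambda>w. of_real (p w) * mpow w m) torus"
    proof (rule infsetsum_infsum, rule abs_summable_on_comparison_test[OF p_sum])
      show "norm (of_real (p w) * mpow w m) \<le> norm (p w)" if "w \<in> torus" for w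
        using that by (simp add: norm_mult norm_mpow)
    qed
    also have "\<dots> = correlation a m" by (rule infsumI[OF sum])
    finally show "correlation a m = (\<integral>z. mpow z m \<partial>\<sigma>)" ..
  qed
  moreover have "discrete_measure \<sigma>"
    unfolding discrete_measure_def
  proof (intro bexI conjI)
    let ?A = "{w \<in> torus. p w \<noteq> 0}"
    show count: "countable ?A" using p_summable by (rule summable_countable_real)
    have "?A \<in> sets borel" using count by (rule sets.countable[rotated]) simp
    then have A: "?A \<in> sets ?T" by (auto simp: sets_restrict_space intro!: image_eqI[of _ _ ?A])
    then show "?A \<in> sets \<sigma>" by (simp add: \<sigma>_def)
    have "space \<sigma> - ?A \<in> sets ?T" using sets.compl_sets[OF A] by (simp add: \<sigma>_def)
    then have "emeasure \<sigma> (space \<sigma> - ?A) = (\<integral>\<^sup>+w\<in>space \<sigma> - ?A. ennreal (p w) \<partial>count_space torus)"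
      by (rule emeasure)
    also have "\<dots> = (\<integral>\<^sup>+w. 0 \<partial>count_space (torus :: (complex ^ 'd) set))"
      by (intro nn_integral_cong) (auto simp: indicator_def)
    finally show "emeasure \<sigma> (space \<sigma> - ?A) = 0" by simp
  qed
  ultimately show ?thesis by blast
qed

section \<open>Membership in class D and the inclusion\<close>

lemma correlation_eqI:
  "(correlation_avg a m \<longlongrightarrow> \<gamma>) at_top \<Longrightarrow> correlation a m = \<gamma>"
  unfolding correlation_def by (rule tendsto_Lim) simp

lemma cnj_vec_mem_torus: "w \<in> torus \<Longrightarrow> (\<chi> j. cnj (w $ j)) \<in> torus"
  by (simp add: torus_def)

lemma mpow_cnj_vec: "mpow (\<chi> j. cnj (w $ j)) (int_vec k) = cnj (mpow w (int_vec k))"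
  by (simp add: mpow_int_vec)

text \<open>Common to the inclusion and the counterexample. The masses \<open>p\<close> are not tied
  to the coefficients \<open>A\<close>, because in the counterexample \<open>A\<close> vanishes and
  \<open>p\<close> does not.\<close>

lemma class_D_I:
  fixes a :: "nat ^ 'd \<Rightarrow> complex"
  assumes A: "has_fourier_coeffs a A" and bdd: "a \<in> bounded_seqs"
    and p: "\<And>w. p w \<ge> 0"
    and corr: "\<And>m. (correlation_avg a m \<longlongrightarrow> \<gamma> m) at_top"
    and sum: "\<And>m. ((\<lambda>w. of_real (p w) * mpow w m) has_sum \<gamma> m) torus"
  shows "a \<in> class_D"
proof -
  have "\<exists>\<sigma>. is_spectral_measure a \<sigma> \<and> discrete_measure \<sigma>"
    by (rule discrete_spectral_measureI[of p]) (simp_all add: p correlation_eqI[OF corr] sum)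
  moreover have "\<exists>l. ((\<lambda>n. (\<Sum>k\<in>{0..n}. a k * mpow z (int_vec k)) / of_nat (box_size n)) \<longlongrightarrow> l) at_top"
    if z: "z \<in> torus" for z
  proof
    \<comment> \<open>Class D averages against \<open>mpow z\<close> itself, hence the Fourier
      coefficient at the conjugate frequency.\<close>
    have "(box_avg (\<lambda>k. a k * mpow z (int_vec k)) \<longlongrightarrow> A (\<chi> j. cnj (z $ j))) at_top"
      using A cnj_vec_mem_torus[OF z] by (auto simp: has_fourier_coeffs_def mpow_cnj_vec)
    then show "((\<lambda>n. (\<Sum>k\<in>{0..n}. a k * mpow z (int_vec k)) / of_nat (box_size n)) \<longlongrightarrow> A (\<chi> j. cnj (z $ j))) at_top"
      by (simp add: box_avg_def[abs_def])
  qed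
  moreover have "a \<in> class_S" using corr by (auto simp: class_S_def)
  ultimately show ?thesis using bdd by (simp add: class_D_def)
qed

lemma besicovitch_1_subset_class_D:
  "besicovitch_1 \<inter> bounded_seqs \<subseteq> (class_D :: (nat ^ 'd \<Rightarrow> complex) set)"
proof
  fix a :: "nat ^ 'd \<Rightarrow> complex" assume a: "a \<in> besicovitch_1 \<inter> bounded_seqs"
  then obtain C where C: "\<And>k. norm (a k) \<le> C"
    by (auto simp: bounded_seqs_def bounded_iff)
  obtain A where A: "has_fourier_coeffs a A"
    using besicovitch_1_has_fourier_coeffs[of a C] a C by blast
  have "\<forall>m. \<exists>l. (correlation_avg a m \<longlongrightarrow> l) at_top"
    using besicovitch_1_in_class_S[of a C] a C by (simp add: class_S_def)
  then obtain \<gamma> where corr: "\<And>m. (correlation_avg a m \<longlongrightarrow> \<gamma> m) at_top" by metis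
  show "a \<in> class_D"
    using A _ _ corr
  proof (rule class_D_I)
    show "((\<lambda>w. of_real ((norm (A w))\<^sup>2) * mpow w m) has_sum \<gamma> m) torus" for m
      using a C by (intro besicovitch_1_correlation_has_sum[OF _ _ A corr]) auto
  qed (use a in auto)
qed

subsection \<open>A slowly oscillating sequence\<close>

definition slow_phase :: "'d \<Rightarrow> nat ^ 'd \<Rightarrow> complex" where
  "slow_phase j k = cis (sqrt (real (k $ j)))"

lemma tendsto_cis_0:
  assumes "(f \<longlongrightarrow> 0) F"
  shows "((\<lambda>x. cis (f x)) \<longlongrightarrow> 1) F"
proof -
  have "((\<lambda>x. exp (\<i> * of_real (f x))) \<longlongrightarrow> exp (\<i> * of_real 0)) F"
    by (intro tendsto_intros assms)
  then show ?thesis by (simp add: cis_conv_exp)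
qed

text \<open>The ratio is \<open>cis\<close> of a difference of roots that tends to 0. For negative
  \<open>m\<close>, a negative radicand occurs for finitely many \<open>t\<close> only.\<close>

lemma cis_sqrt_shift_ratio:
  "(\<lambda>t. cnj (cis (sqrt (real t))) * cis (sqrt (real_of_int (int t + m)))) \<longlonglongrightarrow> 1"
proof -
  have "(\<lambda>t. sqrt (real t + real_of_int m) - sqrt (real t)) \<longlonglongrightarrow> 0"
    by real_asymp
  then have "(\<lambda>t. cis (sqrt (real t + real_of_int m) - sqrt (real t))) \<longlonglongrightarrow> 1"
    by (rule tendsto_cis_0)
  then show ?thesis by (simp add: cis_cnj cis_mult)
qed

text \<open>The ratio for \<open>m = 1\<close>, rescaled by a factor of modulus 1; it supplies the
  increment hypothesis of \<open>cesaro_powers_null\<close>.\<close>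

lemma cis_sqrt_increment: "(\<lambda>t. cis (sqrt (real (Suc t))) - cis (sqrt (real t))) \<longlonglongrightarrow> 0"
proof (rule tendsto_norm_zero_cancel)
  have "norm (cis (sqrt (real (Suc t))) - cis (sqrt (real t))) =
      norm (cnj (cis (sqrt (real t))) * cis (sqrt (real_of_int (int t + 1))) - 1)" for t
  proof -
    have "norm (cis (sqrt (real (Suc t))) - cis (sqrt (real t))) =
      norm (cnj (cis (sqrt (real t))) * (cis (sqrt (real (Suc t))) - cis (sqrt (real t))))"
      by (simp add: norm_mult)
    then show ?thesis by (simp add: right_diff_distrib cis_cnj cis_mult add.commute)
  qed
  moreover have "(\<lambda>t. cnj (cis (sqrt (real t))) * cis (sqrt (real_of_int (int t + 1))) - 1) \<longlonglongrightarrow> 0"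
    using cis_sqrt_shift_ratio[of 1] by (rule LIM_zero)
  ultimately show "(\<lambda>t. norm (cis (sqrt (real (Suc t))) - cis (sqrt (real t)))) \<longlonglongrightarrow> 0"
    by (simp add: tendsto_norm_zero)
qed

text \<open>
  Discrete version of the antiderivative \<open>2/i \<surd>x exp (i \<surd>x)\<close> of \<open>exp (i \<surd>x)\<close> up to lower order
  terms.
\<close>

lemma cesaro_cis_sqrt: "(\<lambda>N. (\<Sum>t\<le>N. cis (sqrt (real t))) / of_nat (Suc N)) \<longlonglongrightarrow> 0"
proof -
  \<comment> \<open>Chosen so that \<open>cis (sqrt t) * q t\<close> is the increment of
    \<open>sqrt t * cis (sqrt t)\<close>. The phase difference behaves like
    \<open>1 / (2 * sqrt t)\<close>, whence the limit \<open>\<i> / 2\<close>.\<close>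
  define q where "q = (\<lambda>t. sqrt (real (Suc t)) * cis (sqrt (real (Suc t)) - sqrt (real t)) - sqrt (real t))"
  have "(\<lambda>t. Complex (sqrt (real (Suc t)) * cos (sqrt (real (Suc t)) - sqrt (real t)) - sqrt (real t))
      (sqrt (real (Suc t)) * sin (sqrt (real (Suc t)) - sqrt (real t)))) \<longlonglongrightarrow> Complex 0 (1/2)"
    by (intro tendsto_Complex; real_asymp)
  moreover have "Complex (sqrt (real (Suc t)) * cos (sqrt (real (Suc t)) - sqrt (real t)) - sqrt (real t))
      (sqrt (real (Suc t)) * sin (sqrt (real (Suc t)) - sqrt (real t))) = q t" for t
    by (simp add: q_def complex_eq_iff)
  moreover have "Complex 0 (1/2) = \<i> / 2" by (simp add: complex_eq_iff)
  ultimately have q: "q \<longlonglongrightarrow> \<i> / 2" by simp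
  have "(\<lambda>t. norm (cis (sqrt (real t)) * (q t - \<i> / 2))) \<longlonglongrightarrow> 0"
    using tendsto_norm_zero[OF LIM_zero[OF q]] by (simp add: norm_mult)
  then have 1: "(\<lambda>N. (\<Sum>t\<le>N. cis (sqrt (real t)) * (q t - \<i> / 2)) / of_nat (Suc N)) \<longlonglongrightarrow> 0"
    by (intro cesaro_null) (rule tendsto_norm_zero_cancel)
  have 2: "(\<lambda>N. sqrt (real (Suc N)) * cis (sqrt (real (Suc N))) / of_nat (Suc N)) \<longlonglongrightarrow> 0"
  proof (rule tendsto_norm_zero_cancel)
    have "(\<lambda>N. sqrt (real (Suc N)) / real (Suc N)) \<longlonglongrightarrow> 0" by real_asymp
    then show "(\<lambda>N. norm (sqrt (real (Suc N)) * cis (sqrt (real (Suc N))) / of_nat (Suc N))) \<longlonglongrightarrow> 0"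
      by (simp add: norm_mult norm_divide del: of_nat_Suc)
  qed
  have tel: "(\<Sum>t\<le>N. cis (sqrt (real t)) * q t) = sqrt (real (Suc N)) * cis (sqrt (real (Suc N)))" for N
  proof (induction N)
    case (Suc N)
    have "cis (sqrt (real t)) * q t = sqrt (real (Suc t)) * cis (sqrt (real (Suc t))) - sqrt (real t) * cis (sqrt (real t))" for t
      by (simp add: q_def right_diff_distrib cis_mult mult.left_commute[of "cis (sqrt (real t))"] mult.commute)
    with Suc show ?case by simp
  qed (simp add: q_def)
  \<comment> \<open>Splitting \<open>q t\<close> into its limit and a null sequence lets the
    telescoped identity be solved for the wanted sum.\<close>
  have "(\<Sum>t\<le>N. cis (sqrt (real t))) / of_nat (Suc N) = 2 / \<i> *
     (sqrt (real (Suc N)) * cis (sqrt (real (Suc N))) / of_nat (Suc N) -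
      (\<Sum>t\<le>N. cis (sqrt (real t)) * (q t - \<i> / 2)) / of_nat (Suc N))" for N
  proof -
    have "(\<Sum>t\<le>N. cis (sqrt (real t)) * (q t - \<i> / 2)) =
      sqrt (real (Suc N)) * cis (sqrt (real (Suc N))) - (\<Sum>t\<le>N. cis (sqrt (real t))) * (\<i> / 2)"
      by (simp add: tel right_diff_distrib sum_subtractf sum_distrib_right sum_divide_distrib del: of_nat_Suc)
    then show ?thesis by (simp add: diff_divide_distrib mult_ac del: of_nat_Suc)
  qed
  then show ?thesis
    using tendsto_mult[OF tendsto_const[of "2 / \<i>"] tendsto_diff[OF 2 1]] by simp
qed

lemma cesaro_cis_sqrt_mult_power:
  assumes "norm z = 1"
  shows "(\<lambda>N. (\<Sum>t\<le>N. cis (sqrt (real t)) * z ^ t) / of_nat (Suc N)) \<longlonglongrightarrow> 0"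
proof (cases "z = 1")
  case True
  then show ?thesis using cesaro_cis_sqrt by simp
next
  case False
  then show ?thesis
    using assms cis_sqrt_increment by (intro cesaro_powers_null) (auto simp: bounded_iff)
qed

text \<open>The average factors over the coordinates, and the factor at \<open>i\<close> has mean 0
  whatever the frequency.\<close>

lemma slow_phase_fourier_coeffs:
  fixes i :: "'d::finite"
  shows "has_fourier_coeffs (slow_phase i) (\<lambda>_. 0)"
  unfolding has_fourier_coeffs_def
proof
  fix w :: "complex ^ 'd" assume w: "w \<in> torus"
  define z where "z = (\<chi> j. cnj (w $ j))"
  have z: "norm (z $ j) = 1" for j using w by (simp add: z_def torus_def)
  define f where "f = (\<lambda>j t. (if j = i then cis (sqrt (real t)) else 1) * (z $ j) ^ t)"
  define l :: "'d \<Rightarrow> complex" where "l = (\<lambda>j. if j = i then 0 else if z $ j = 1 then 1 else 0)"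
  have "(\<lambda>N. (\<Sum>t\<le>N. f j t) / of_nat (Suc N)) \<longlonglongrightarrow> l j" for j
    using cesaro_cis_sqrt_mult_power[OF z[of j]] cesaro_powers[OF z[of j]]
    by (cases "j = i") (simp_all add: f_def l_def del: of_nat_Suc)
  then have "(box_avg (\<lambda>k. \<Prod>j\<in>UNIV. f j (k $ j)) \<longlongrightarrow> (\<Prod>j\<in>UNIV. l j)) at_top"
    by (rule tendsto_box_avg_prod)
  moreover have "(\<Prod>j\<in>UNIV. f j (k $ j)) = slow_phase i k * cnj (mpow w (int_vec k))" for k
    by (simp add: f_def prod.distrib prod.delta slow_phase_def mpow_int_vec z_def)
  moreover have "(\<Prod>j\<in>UNIV. l j) = 0" by (rule prod_zero) (auto simp: l_def)
  ultimately show "(box_avg (\<lambda>k. slow_phase i k * cnj (mpow w (int_vec k))) \<longlongrightarrow> 0) at_top"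
    by simp
qed

text \<open>The product factors over the coordinates: each factor is the indicator of staying in the
  orthant, which is eventually 1, times the phase ratio in the case of \<open>i\<close>. All of them
  tend to 1.\<close>

lemma slow_phase_correlation:
  fixes m :: "int ^ 'd" and i :: 'd
  shows "(correlation_avg (slow_phase i) m \<longlongrightarrow> 1) at_top"
proof -
  define f where "f = (\<lambda>j t. if 0 \<le> int t + m $ j then
    (if j = i then cnj (cis (sqrt (real t))) * cis (sqrt (real_of_int (int t + m $ j))) else 1) else 0)"
  have "(\<lambda>N. (\<Sum>t\<le>N. f j t) / of_nat (Suc N)) \<longlonglongrightarrow> 1" for j
  proof (rule cesaro)
    have "\<forall>\<^sub>F t in sequentially. (if j = i then cnj (cis (sqrt (real t))) * cis (sqrt (real_of_int (int t + m $ j))) else 1) = f j t"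
      by (rule eventually_sequentiallyI[of "nat \<bar>m $ j\<bar>"]) (auto simp: f_def)
    moreover have "(\<lambda>t. if j = i then cnj (cis (sqrt (real t))) * cis (sqrt (real_of_int (int t + m $ j))) else 1) \<longlonglongrightarrow> 1"
      using cis_sqrt_shift_ratio[of "m $ j"] by (cases "j = i") simp_all
    ultimately show "f j \<longlonglongrightarrow> 1" by (rule Lim_transform_eventually[rotated])
  qed
  then have "(box_avg (\<lambda>k. \<Prod>j\<in>UNIV. f j (k $ j)) \<longlongrightarrow> (\<Prod>j\<in>(UNIV::'d set). 1)) at_top"
    by (rule tendsto_box_avg_prod)
  moreover have "(\<Prod>j\<in>UNIV. f j (k $ j)) = cnj (slow_phase i k) * zero_ext (slow_phase i) (int_vec k + m)" for k
  proof (cases "\<forall>j. 0 \<le> int (k $ j) + m $ j")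
    case True
    then have "(\<Prod>j\<in>UNIV. f j (k $ j)) = (\<Prod>j\<in>UNIV. if j = i then
        cnj (cis (sqrt (real (k $ j)))) * cis (sqrt (real_of_int (int (k $ j) + m $ j))) else 1)"
      by (simp add: f_def)
    also have "\<dots> = cnj (cis (sqrt (real (k $ i)))) * cis (sqrt (real_of_int (int (k $ i) + m $ i)))"
      by (subst prod.delta) auto
    finally show ?thesis using True by (simp add: zero_ext_def slow_phase_def int_vec_def del: of_int_add)
  next
    case False
    then have "(\<Prod>j\<in>UNIV. f j (k $ j)) = 0" by (auto simp: f_def prod_zero_iff)
    then show ?thesis using False by (auto simp: zero_ext_def int_vec_def)
  qed
  ultimately show ?thesis unfolding correlation_avg_eq_box_avg by simp
qed

lemma norm_slow_phase [simp]: "norm (slow_phase i k) = 1"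
  by (simp add: slow_phase_def)

lemma slow_phase_in_class_D: "slow_phase i \<in> class_D"
proof (rule class_D_I)
  show "has_fourier_coeffs (slow_phase i) (\<lambda>_. 0)" by (rule slow_phase_fourier_coeffs)
  show "slow_phase i \<in> bounded_seqs"
    unfolding bounded_seqs_def bounded_iff by (auto intro: exI[of _ 1])
  show "(correlation_avg (slow_phase i) m \<longlongrightarrow> 1) at_top" for m by (rule slow_phase_correlation)
  \<comment> \<open>The constant correlation 1 is the Fourier transform of the unit mass at the
    point 1.\<close>
  show "((\<lambda>w. of_real (of_bool (w = 1)) * mpow w m) has_sum 1) torus" for m :: "int ^ 'a"
    by (rule has_sum_finite_neutralI[where B = "{1}"]) (auto simp: torus_def mpow_def)
qed simp

text \<open>Comparison at \<open>m = 0\<close>: with all Fourier coefficients zero the series sums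
  to 0, while the correlation there is 1.\<close>

lemma slow_phase_not_in_besicovitch_1: "slow_phase i \<notin> besicovitch_1"
proof
  assume "slow_phase i \<in> besicovitch_1"
  then have "((\<lambda>w. of_real ((norm (0 :: complex))\<^sup>2) * mpow w 0) has_sum 1) (torus :: (complex ^ 'a) set)"
    by (rule besicovitch_1_correlation_has_sum[where C = 1 and A = "\<lambda>_. 0"])
       (simp_all add: slow_phase_fourier_coeffs slow_phase_correlation)
  then have "((\<lambda>_. 0 :: complex) has_sum 1) (torus :: (complex ^ 'a) set)" by simp
  then show False using has_sum_unique[OF has_sum_0] by fastforce
qed

theorem mainTheorem4:
  shows "besicovitch_1 \<inter> bounded_seqs \<subset> (class_D :: (nat ^ 'd \<Rightarrow> complex) set)"
  using besicovitch_1_subset_class_D slow_phase_in_class_D slow_phase_not_in_besicovitch_1 by blast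

end
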